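(* Let $e_1,e_2,e_3$ be the unit vectors of $\mathbb{R}^3$, $z=(0,0,0)$, and let $\mathcal{T}=\{T_{jk\ell}: (j,k,\ell)\in\{1,2\}^3\}$ with $T_{jk\ell}=\operatorname{conv}\{z,(-1)^je_1,(-1)^ke_2,(-1)^\ell e_3\}$. Let $\Omega=\bigcup\mathcal{T}$ be the corresponding domain with pure Dirichlet boundary $\Gamma_D=\partial\Omega$. Define the piecewise constant function $\tilde q$ by $$\tilde q|_{T_{111}}=\tilde q|_{T_{112}}=1,\quad \tilde q|_{T_{121}}=\tilde q|_{T_{122}}=0,\quad \tilde q|_{T_{211}}=\tilde q|_{T_{212}}=0,\quad \tilde q|_{T_{221}}=\tilde q|_{T_{222}}=1,$$ and let $q=\tilde q-\int_\Omega\tilde q\,dx$. Then $$\int_\Omega q\,\operatorname{div}_h v_h\,dx=0\qquad\text{for all } v_h\in V_{h,D}:=S^{\mathrm{C},1}_D\times S^{\mathrm{C},1}_D\times S^{\mathrm{NC},1}_D .$$ Consequently, the inf-sup condition $$\|p_h\|_{L^2(\Omega)}\lesssim\sup_{v_h\in V_{h,D}\setminus\{0\}}\frac{b_h(v_h,p_h)}{\|\nabla_h v_h\|_{L^2(\Omega)}}\qquad\text{for all }p_h\in Q_h$$ cannot hold for $V_{h,D}=S^{\mathrm{C},1}_D\times S^{\mathrm{C},1}_D\times S^{\mathrm{NC},1}_D$, and hence a discretisation of the Stokes problem with this velocity space (and pressure space $Q_h$) is not stable.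
   Context: $S^{\mathrm{C},1}_D=\{v\in H^1(\Omega): v=0\text{ on }\Gamma_D,\ v|_T \text{ affine } \forall T\in\mathcal{T}\}$. $S^{\mathrm{NC},1}_D=\{v\in L^2(\Omega): v|_T\text{ affine } \forall T\in\mathcal{T},\ \int_F[v]_F\,ds=0\text{ for all interior faces }F,\ \int_F v\,ds=0\text{ for all faces }F\subseteq\Gamma_D\}$, where $[v]_F$ is the jump of $v$ across $F$. $Q_h$ is the space of all functions in $L^2(\Omega)$ that are constant on each $T\in\mathcal{T}$. $\nabla_h$ and $\operatorname{div}_h$ are the gradient and divergence taken elementwise on $\mathcal{T}$, and $b_h(v_h,p_h)=-\int_\Omega p_h\operatorname{div}_h v_h\,dx$. $A\lesssim B$ means $A\le CB$ with a mesh-size independent constant $0\le C<\infty$. *)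

theory Defs
  imports "HOL-Analysis.Analysis"
begin

section \<open>Lebesgue and Sobolev spaces\<close>

definition L2 :: "(real^3) set \<Rightarrow> (real^3 \<Rightarrow> 'b::euclidean_space) set" where
  "L2 U = {f. f \<in> borel_measurable (lebesgue_on U) \<and>
              integrable (lebesgue_on U) (\<lambda>x. (norm (f x))\<^sup>2)}"

definition L2norm :: "(real^3) set \<Rightarrow> (real^3 \<Rightarrow> 'b::euclidean_space) \<Rightarrow> real" where
  "L2norm U f = sqrt (LINT x|lebesgue_on U. (norm (f x))\<^sup>2)"

definition partial :: "3 \<Rightarrow> (real^3 \<Rightarrow> real) \<Rightarrow> real^3 \<Rightarrow> real" where
  "partial i f x = frechet_derivative f (at x) (axis i 1)"

definition smooth :: "(real^3 \<Rightarrow> real) \<Rightarrow> bool" where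
  "smooth f \<longleftrightarrow> (\<forall>is x. foldr partial is f differentiable (at x))"

definition test_function :: "(real^3) set \<Rightarrow> (real^3 \<Rightarrow> real) \<Rightarrow> bool" where
  "test_function U \<phi> \<longleftrightarrow>
     smooth \<phi> \<and> compact (closure {x. \<phi> x \<noteq> 0}) \<and> closure {x. \<phi> x \<noteq> 0} \<subseteq> U"

definition H1 :: "(real^3) set \<Rightarrow> (real^3 \<Rightarrow> real) set" where
  "H1 U = {v \<in> L2 U. \<forall>i. \<exists>g \<in> L2 U. \<forall>\<phi>. test_function U \<phi> \<longrightarrow>
     (LINT x|lebesgue_on U. v x * partial i \<phi> x) = - (LINT x|lebesgue_on U. g x * \<phi> x)}"

section \<open>Piecewise affine finite element spaces\<close>

text \<open>A mesh is a set of closed tetrahedra. A function which is discontinuous across faces has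
  no single value there, so the restriction of a function to an element is understood on the
  interior of the element, and its values on the closed element are the limits from the
  interior. The values of the function itself on the (null) union of all faces never matter.\<close>

definition domain :: "(real^3) set set \<Rightarrow> (real^3) set" where
  "domain \<T> = interior (\<Union>\<T>)"

definition affine_on_element :: "(real^3) set \<Rightarrow> (real^3 \<Rightarrow> real) \<Rightarrow> bool" where
  "affine_on_element T v \<longleftrightarrow> (\<exists>a b. \<forall>x \<in> interior T. v x = a \<bullet> x + b)"

definition elem_trace :: "(real^3) set \<Rightarrow> (real^3 \<Rightarrow> real) \<Rightarrow> real^3 \<Rightarrow> real" where
  "elem_trace T v x = Lim (at x within interior T) v"

text \<open>Surface integral over the triangle with vertices \<open>a\<close>, \<open>b\<close>, \<open>c\<close>, by its affine
  parametrisation over the reference triangle.\<close>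

definition triangle_integral ::
    "real^3 \<Rightarrow> real^3 \<Rightarrow> real^3 \<Rightarrow> (real^3 \<Rightarrow> real) \<Rightarrow> real" where
  "triangle_integral a b c f =
     norm (cross3 (b - a) (c - a)) *
     (LINT y|lebesgue_on {(s, t). 0 \<le> s \<and> 0 \<le> t \<and> s + t \<le> (1::real)}.
        f (a + fst y *\<^sub>R (b - a) + snd y *\<^sub>R (c - a)))"

definition SC :: "(real^3) set set \<Rightarrow> (real^3) set \<Rightarrow> (real^3 \<Rightarrow> real) set" where
  "SC \<T> \<Gamma> = {v \<in> H1 (domain \<T>).
     (\<forall>T \<in> \<T>. affine_on_element T v) \<and>
     (\<forall>T \<in> \<T>. \<forall>x \<in> T \<inter> \<Gamma>. elem_trace T v x = 0)}"

text \<open>The interior faces are the facets shared by two different elements.\<close>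

definition SNC :: "(real^3) set set \<Rightarrow> (real^3) set \<Rightarrow> (real^3 \<Rightarrow> real) set" where
  "SNC \<T> \<Gamma> = {v \<in> L2 (domain \<T>).
     (\<forall>T \<in> \<T>. affine_on_element T v) \<and>
     (\<forall>T \<in> \<T>. \<forall>T' \<in> \<T>. \<forall>a b c.
        T \<noteq> T' \<and> convex hull {a, b, c} facet_of T \<and> convex hull {a, b, c} facet_of T' \<longrightarrow>
        triangle_integral a b c (\<lambda>x. elem_trace T v x - elem_trace T' v x) = 0) \<and>
     (\<forall>T \<in> \<T>. \<forall>a b c.
        convex hull {a, b, c} facet_of T \<and> convex hull {a, b, c} \<subseteq> \<Gamma> \<longrightarrow>
        triangle_integral a b c (elem_trace T v) = 0)}"

definition velocities :: "(real^3) set set \<Rightarrow> (real^3) set \<Rightarrow> (real^3 \<Rightarrow> real^3) set" where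
  "velocities \<T> \<Gamma> = {v. (\<lambda>x. v x $ 1) \<in> SC \<T> \<Gamma> \<and> (\<lambda>x. v x $ 2) \<in> SC \<T> \<Gamma> \<and>
                        (\<lambda>x. v x $ 3) \<in> SNC \<T> \<Gamma>}"

definition pressures :: "(real^3) set set \<Rightarrow> (real^3 \<Rightarrow> real) set" where
  "pressures \<T> = {p \<in> L2 (domain \<T>). \<forall>T \<in> \<T>. \<exists>c. \<forall>x \<in> interior T. p x = c}"

definition zero_mean :: "(real^3) set set \<Rightarrow> (real^3 \<Rightarrow> real) set" where
  "zero_mean \<T> = {p. (LINT x|lebesgue_on (domain \<T>). p x) = 0}"

section \<open>Discrete Stokes problem\<close>

definition partial_h :: "(real^3) set set \<Rightarrow> 3 \<Rightarrow> (real^3 \<Rightarrow> real) \<Rightarrow> real^3 \<Rightarrow> real" where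
  "partial_h \<T> i f x = (if \<exists>T \<in> \<T>. x \<in> interior T then partial i f x else 0)"

definition grad_h :: "(real^3) set set \<Rightarrow> (real^3 \<Rightarrow> real^3) \<Rightarrow> real^3 \<Rightarrow> real^3^3" where
  "grad_h \<T> v x = (\<chi> i j. partial_h \<T> j (\<lambda>y. v y $ i) x)"

definition div_h :: "(real^3) set set \<Rightarrow> (real^3 \<Rightarrow> real^3) \<Rightarrow> real^3 \<Rightarrow> real" where
  "div_h \<T> v x = (\<Sum>i\<in>UNIV. partial_h \<T> i (\<lambda>y. v y $ i) x)"

definition b_h :: "(real^3) set set \<Rightarrow> (real^3 \<Rightarrow> real^3) \<Rightarrow> (real^3 \<Rightarrow> real) \<Rightarrow> real" where
  "b_h \<T> v p = - (LINT x|lebesgue_on (domain \<T>). p x * div_h \<T> v x)"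

definition nonzero :: "(real^3) set set \<Rightarrow> (real^3 \<Rightarrow> real^3) \<Rightarrow> bool" where
  "nonzero \<T> v \<longleftrightarrow> \<not> (AE x in lebesgue_on (domain \<T>). v x = 0)"

text \<open>The supremum is taken in the extended reals, so no boundedness has to be presupposed.\<close>

definition inf_sup ::
    "(real^3) set set \<Rightarrow> (real^3 \<Rightarrow> real^3) set \<Rightarrow> (real^3 \<Rightarrow> real) set \<Rightarrow> bool" where
  "inf_sup \<T> V Q \<longleftrightarrow> (\<exists>C::real. 0 \<le> C \<and> (\<forall>p \<in> Q.
     ereal (L2norm (domain \<T>) p) \<le>
       ereal C * (SUP v \<in> {v \<in> V. nonzero \<T> v}.
                    ereal (b_h \<T> v p / L2norm (domain \<T>) (grad_h \<T> v)))))"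

text \<open>\<open>A\<close> is the viscosity tensor: \<open>A M = \<mu> *\<^sub>R M\<close> gives the form
  \<open>\<mu> \<integral> \<nabla>\<^sub>h u : \<nabla>\<^sub>h v\<close>, and \<open>A M = \<mu> *\<^sub>R (M + transpose M)\<close> gives the form
  \<open>2 \<mu> \<integral> \<epsilon>\<^sub>h u : \<epsilon>\<^sub>h v\<close> in the symmetric gradient.\<close>

definition stokes_solution ::
    "(real^3) set set \<Rightarrow> (real^3^3 \<Rightarrow> real^3^3) \<Rightarrow> (real^3 \<Rightarrow> real^3) set \<Rightarrow>
     (real^3 \<Rightarrow> real) set \<Rightarrow> (real^3 \<Rightarrow> real^3) \<Rightarrow> (real^3 \<Rightarrow> real^3) \<Rightarrow> (real^3 \<Rightarrow> real) \<Rightarrow> bool" where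
  "stokes_solution \<T> A V Q f u p \<longleftrightarrow> u \<in> V \<and> p \<in> Q \<and>
     (\<forall>v \<in> V. (LINT x|lebesgue_on (domain \<T>). A (grad_h \<T> u x) \<bullet> grad_h \<T> v x) + b_h \<T> v p
              = (LINT x|lebesgue_on (domain \<T>). f x \<bullet> v x)) \<and>
     (\<forall>r \<in> Q. b_h \<T> u r = 0)"

definition stokes_stable ::
    "(real^3) set set \<Rightarrow> (real^3^3 \<Rightarrow> real^3^3) \<Rightarrow> (real^3 \<Rightarrow> real^3) set \<Rightarrow>
     (real^3 \<Rightarrow> real) set \<Rightarrow> bool" where
  "stokes_stable \<T> A V Q \<longleftrightarrow> (\<exists>C::real. 0 \<le> C \<and>
     (\<forall>f \<in> L2 (domain \<T>). \<forall>u p. stokes_solution \<T> A V Q f u p \<longrightarrow>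
        L2norm (domain \<T>) (grad_h \<T> u) + L2norm (domain \<T>) p \<le> C * L2norm (domain \<T>) f))"

section \<open>The mesh of the octahedron\<close>

definition Tet :: "nat \<Rightarrow> nat \<Rightarrow> nat \<Rightarrow> (real^3) set" where
  "Tet j k l = convex hull
     {0, (-1) ^ j *\<^sub>R axis 1 1, (-1) ^ k *\<^sub>R axis 2 1, (-1) ^ l *\<^sub>R axis 3 1}"

definition octa :: "(real^3) set set" where
  "octa = {Tet j k l | j k l. j \<in> {1, 2} \<and> k \<in> {1, 2} \<and> l \<in> {1, 2}}"

end

theory Submission
  imports Defs
begin

text \<open>A conforming function that vanishes on the boundary has the form \<open>c\<^sub>T (1 - \<bar>x\<^sub>1\<bar> - \<bar>x\<^sub>2\<bar> - \<bar>x\<^sub>3\<bar>)\<close> on each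
  element, and membership in \<open>H\<^sup>1\<close> forces all \<open>c\<^sub>T\<close> to agree. Its first and second partial derivatives
  are therefore \<open>- c s\<^sub>1\<close> and \<open>- c s\<^sub>2\<close>, where \<open>s\<close> is the sign vector of the octant, and their products
  with \<open>q = (1 + s\<^sub>1 s\<^sub>2) / 2 - const\<close> sum to zero over the eight octants.
  For a nonconforming function, the zero mean over the outer face of \<open>T\<close> gives
  \<open>\<partial>\<^sub>3 v = - 3 s\<^sub>3 m\<close>, where \<open>m\<close> is its mean over the face in the plane \<open>x\<^sub>3 = 0\<close>. The two elements
  that meet in this face share \<open>m\<close> and carry the same value of \<open>q\<close>, so their contributions cancel.
  Hence \<open>q\<close> is a spurious pressure mode. The constant in \<open>q\<close> is arbitrary, so that the choice \<open>1 / 2\<close>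
  settles the case of pressures with zero mean.\<close>

section \<open>Smooth bump functions\<close>

text \<open>For \<open>k = 0\<close> this is the classical flat function. Powers of
  \<open>1 / t\<close> are built in because differentiation produces them: the family is closed
  under derivatives up to linear combinations.\<close>

definition exp_inv :: "nat \<Rightarrow> real \<Rightarrow> real" where
  "exp_inv k t = (if t > 0 then exp (- 1 / t) / t ^ k else 0)"

text \<open>From the right, the substitution \<open>u = 1 / t\<close> turns the limit into
  \<open>u ^ k / exp u\<close> at infinity; from the left the function vanishes.\<close>

lemma exp_inv_tendsto_0: "(exp_inv k \<longlongrightarrow> 0) (at 0)"
proof -
  have "((\<lambda>t. inverse t ^ k / exp (inverse t)) \<longlongrightarrow> (0::real)) (at_right 0)"
    by (rule filterlim_compose[OF tendsto_power_div_exp_0 filterlim_inverse_at_top_right])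
  then have "(exp_inv k \<longlongrightarrow> 0) (at_right 0)"
    by (rule Lim_transform_eventually)
      (auto simp: exp_inv_def eventually_at_filter exp_minus field_simps)
  moreover have "(exp_inv k \<longlongrightarrow> 0) (at_left 0)"
    by (rule tendsto_eventually) (auto simp: exp_inv_def eventually_at_filter)
  ultimately show ?thesis
    by (simp add: filterlim_at_split)
qed

lemma exp_inv_has_derivative:
  "(exp_inv k has_real_derivative (exp_inv (k + 2) t - real k * exp_inv (k + 1) t)) (at t)"
proof (cases t "0::real" rule: linorder_cases)
  case less
  have "((\<lambda>_. 0) has_real_derivative 0) (at t)" by simp
  then have "(exp_inv k has_real_derivative 0) (at t)"
    by (rule has_field_derivative_transform_within[where d = "-t"])
      (use less in \<open>auto simp: exp_inv_def dist_real_def\<close>)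
  with less show ?thesis by (simp add: exp_inv_def)
next
  case equal
  \<comment> \<open>The difference quotient at 0 is \<open>exp_inv (k + 1)\<close> itself, so
    differentiability at 0 reduces to the limit above.\<close>
  have "((\<lambda>h. exp_inv (k + 1) h) \<longlongrightarrow> 0) (at 0)" by (rule exp_inv_tendsto_0)
  then have "((\<lambda>h. (exp_inv k (0 + h) - exp_inv k 0) / h) \<longlongrightarrow> 0) (at 0)"
    by (rule Lim_transform_eventually) (auto simp: exp_inv_def eventually_at_filter field_simps)
  with equal show ?thesis by (simp add: exp_inv_def DERIV_def)
next
  case greater
  \<comment> \<open>The power rule yields the exponent \<open>k - Suc 0\<close> in truncated
    subtraction; this absorbs the extra factor \<open>t\<close>, with the case \<open>n = 0\<close>
    kept apart.\<close>
  have pw: "t * t ^ (n - Suc 0) = (if n = 0 then t else t ^ n)" for n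
    by (cases n) auto
  have "((\<lambda>t. exp (- 1 / t) / t ^ k) has_real_derivative
      (exp_inv (k + 2) t - real k * exp_inv (k + 1) t)) (at t)"
    using greater
    by (cases k) (auto intro!: derivative_eq_intros simp: exp_inv_def field_simps power2_eq_square pw)
  then show ?thesis
    by (rule has_field_derivative_transform_within[where d = t])
      (use greater in \<open>auto simp: exp_inv_def dist_real_def\<close>)
qed

lemma exp_inv_continuous: "continuous_on UNIV (exp_inv k)"
  by (rule DERIV_continuous_on, rule has_field_derivative_at_within, rule exp_inv_has_derivative)

text \<open>The derivative is written with sums, products and constants only, the operations under
  which \<open>smooth_class\<close> is closed.\<close>

lemma exp_inv_has_derivative_compose:
  assumes "(f has_derivative f') (at x)"
  shows "((\<lambda>x. exp_inv k (f x)) has_derivative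
    (\<lambda>h. f' h * (exp_inv (k + 2) (f x) + (- real k) * exp_inv (k + 1) (f x)))) (at x)"
proof -
  have "(exp_inv k has_derivative
      (\<lambda>h. h * (exp_inv (k + 2) (f x) + (- real k) * exp_inv (k + 1) (f x)))) (at (f x))"
    using exp_inv_has_derivative[of k "f x"] unfolding has_field_derivative_def
    by (simp add: mult.commute[of _ "exp_inv _ _ - _"] cong: if_cong)
  from has_derivative_compose[OF assms this] show ?thesis .
qed

text \<open>A class of functions that contains the bumps and is closed under partial derivatives; this gives
  smoothness in the sense of \<open>smooth\<close> by induction on the list of derivatives.\<close>

inductive_set smooth_class :: "(real^3 \<Rightarrow> real) set" where
  const: "(\<lambda>_. c) \<in> smooth_class"
| coord: "(\<lambda>x. x $ i) \<in> smooth_class"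
| add: "f \<in> smooth_class \<Longrightarrow> g \<in> smooth_class \<Longrightarrow> (\<lambda>x. f x + g x) \<in> smooth_class"
| mult: "f \<in> smooth_class \<Longrightarrow> g \<in> smooth_class \<Longrightarrow> (\<lambda>x. f x * g x) \<in> smooth_class"
| exp_inv: "f \<in> smooth_class \<Longrightarrow> (\<lambda>x. exp_inv k (f x)) \<in> smooth_class"

lemma smooth_class_sum:
  assumes "finite A" "\<And>m. m \<in> A \<Longrightarrow> f m \<in> smooth_class"
  shows "(\<lambda>x. \<Sum>m\<in>A. f m x) \<in> smooth_class"
  using assms
proof (induction A)
  case empty
  then show ?case by (simp add: smooth_class.const)
next
  case (insert a A)
  then show ?case using smooth_class.add[of "f a" "\<lambda>x. \<Sum>m\<in>A. f m x"] by simp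
qed

lemma partial_eq:
  assumes "(f has_derivative f') (at x)"
  shows "partial i f x = f' (axis i 1)"
  using frechet_derivative_at[OF assms] by (simp add: partial_def)

text \<open>Both claims go through one induction, since the product and chain rules for partial
  derivatives need the differentiability of the constituents.\<close>

lemma smooth_class_partial:
  assumes "f \<in> smooth_class"
  shows "f differentiable (at x)" "partial i f \<in> smooth_class"
proof -
  have "(\<forall>x. f differentiable (at x)) \<and> (\<forall>i. partial i f \<in> smooth_class)"
    using assms
  proof induction
    case (const c)
    have "partial i (\<lambda>_. c) = (\<lambda>_. 0)" for i
      by (rule ext) (subst partial_eq[OF has_derivative_const], simp)
    then show ?case by (auto intro: smooth_class.const)
  next
    case (coord j)
    have d: "((\<lambda>x. x $ j) has_derivative (\<lambda>x. x $ j)) (at x)" for x :: "real^3"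
      by (rule bounded_linear_imp_has_derivative[OF bounded_linear_vec_nth])
    have "partial i (\<lambda>x. x $ j) = (\<lambda>_. axis i 1 $ j)" for i
      by (rule ext) (subst partial_eq[OF d], simp)
    then show ?case using d by (auto intro: smooth_class.const simp: differentiable_def)
  next
    case (add f g)
    have d: "((\<lambda>x. f x + g x) has_derivative
        (\<lambda>h. frechet_derivative f (at x) h + frechet_derivative g (at x) h)) (at x)" for x
      using add by (intro has_derivative_add) (auto simp: frechet_derivative_works)
    have "partial i (\<lambda>x. f x + g x) = (\<lambda>x. partial i f x + partial i g x)" for i
      by (rule ext) (subst partial_eq[OF d], simp add: partial_def)
    then show ?case using d add by (auto intro: smooth_class.add simp: differentiable_def)
  next
    case (mult f g)
    have d: "((\<lambda>x. f x * g x) has_derivative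
        (\<lambda>h. f x * frechet_derivative g (at x) h + frechet_derivative f (at x) h * g x)) (at x)" for x
      using mult by (intro has_derivative_mult) (auto simp: frechet_derivative_works)
    have p: "partial i (\<lambda>x. f x * g x) = (\<lambda>x. f x * partial i g x + partial i f x * g x)" for i
      by (rule ext) (subst partial_eq[OF d], simp add: partial_def)
    have "partial i (\<lambda>x. f x * g x) \<in> smooth_class" for i
      unfolding p using mult by (intro smooth_class.add smooth_class.mult) auto
    then show ?case using d by (auto simp: differentiable_def)
  next
    case (exp_inv f k)
    have d: "((\<lambda>x. exp_inv k (f x)) has_derivative
        (\<lambda>h. frechet_derivative f (at x) h *
           (exp_inv (k + 2) (f x) + (- real k) * exp_inv (k + 1) (f x)))) (at x)" for x
      using exp_inv by (intro exp_inv_has_derivative_compose) (auto simp: frechet_derivative_works)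
    have p: "partial i (\<lambda>x. exp_inv k (f x)) = (\<lambda>x. partial i f x *
        (exp_inv (k + 2) (f x) + (- real k) * exp_inv (k + 1) (f x)))" for i
      by (rule ext) (subst partial_eq[OF d], simp add: partial_def)
    have "partial i (\<lambda>x. exp_inv k (f x)) \<in> smooth_class" for i
      unfolding p using exp_inv
      by (intro smooth_class.add smooth_class.mult smooth_class.exp_inv smooth_class.const) auto
    then show ?case using d by (auto simp: differentiable_def)
  qed
  then show "f differentiable (at x)" "partial i f \<in> smooth_class" by auto
qed

lemma smooth_class_smooth:
  assumes "f \<in> smooth_class"
  shows "smooth f"
proof -
  have "foldr partial is f \<in> smooth_class" for "is"
    using assms smooth_class_partial(2) by (induction "is") auto
  then show ?thesis unfolding smooth_def using smooth_class_partial(1) by blast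
qed

text \<open>Change of variables for a diagonal map. The value \<open>k = -1\<close> serves for
  parity in one coordinate, large \<open>k\<close> for squeezing the bumps.\<close>

lemma lborel_integral_stretch:
  fixes f :: "real^3 \<Rightarrow> real"
  assumes f: "f \<in> borel_measurable borel" and k: "k \<noteq> 0"
  shows "(LINT x|lborel. f x) = \<bar>k\<bar> * (LINT x|lborel. f (\<chi> m. if m = i then k * x $ m else x $ m))"
proof -
  define c :: "real^3 \<Rightarrow> real" where "c = (\<lambda>b. if b = axis i 1 then k else 1)"
  \<comment> \<open>The summand 0 and the sum over \<open>Basis\<close> match the affine maps of
    \<open>lborel_affine_euclidean\<close>.\<close>
  define T :: "real^3 \<Rightarrow> real^3" where "T = (\<lambda>x. 0 + (\<Sum>j\<in>Basis. (c j * (x \<bullet> j)) *\<^sub>R j))"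
  have T: "T x = (\<chi> m. if m = i then k * x $ m else x $ m)" for x
  proof -
    have "T x = (\<Sum>m\<in>UNIV. (c (axis m 1) * x $ m) *\<^sub>R axis m 1)"
      by (simp add: T_def Basis_vec_def UNION_singleton_eq_range sum.reindex inj_on_def
          axis_eq_axis inner_axis)
    also have "\<dots> = (\<chi> m. if m = i then k * x $ m else x $ m)"
      by (auto simp: vec_eq_iff c_def axis_eq_axis sum.delta axis_def if_distrib cong: if_cong)
    finally show ?thesis .
  qed
  have prod: "(\<Prod>j\<in>Basis. \<bar>c j\<bar>) = \<bar>k\<bar>"
  proof -
    have "(\<Prod>j\<in>Basis. \<bar>c j\<bar>) = (\<Prod>m\<in>UNIV. \<bar>c (axis m 1)\<bar>)"
      by (simp add: Basis_vec_def UNION_singleton_eq_range prod.reindex inj_on_def axis_eq_axis)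
    also have "\<dots> = \<bar>k\<bar>" by (simp add: c_def axis_eq_axis if_distrib cong: if_cong)
    finally show ?thesis .
  qed
  have "lborel = density (distr lborel borel T) (\<lambda>_. ennreal (\<Prod>j\<in>Basis. \<bar>c j\<bar>))"
    unfolding T_def by (rule lborel_affine_euclidean) (use k in \<open>auto simp: c_def\<close>)
  then have "(LINT x|lborel. f x) = (LINT x|density (distr lborel borel T) (\<lambda>_. ennreal \<bar>k\<bar>). f x)"
    by (simp add: prod)
  also have "\<dots> = \<bar>k\<bar> * (LINT x|lborel. f (T x))"
    using f by (subst integral_density) (auto simp: integral_distr T_def)
  finally show ?thesis by (simp add: T)
qed

section \<open>Piecewise weakly differentiable functions\<close>

text \<open>Weak derivatives are tested over \<open>lebesgue_on \<Omega>\<close>, whereas the change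
  of variables lives on \<open>lborel\<close>; for compact support inside \<Omega> the two integrals
  agree.\<close>

lemma integral_lebesgue_on_continuous:
  fixes f :: "real^3 \<Rightarrow> real"
  assumes "continuous_on UNIV f" "compact K" "\<And>x. x \<notin> K \<Longrightarrow> f x = 0" "K \<subseteq> \<Omega>" "open \<Omega>"
  shows "integrable lborel f" "integrable (lebesgue_on \<Omega>) f"
    "(LINT x|lebesgue_on \<Omega>. f x) = (LINT x|lborel. f x)"
proof -
  have "continuous_on K f" using assms(1) by (rule continuous_on_subset) auto
  then have "integrable lborel (\<lambda>x. indicator K x *\<^sub>R f x)"
    by (rule borel_integrable_compact[OF assms(2)])
  moreover have "(\<lambda>x. indicator K x *\<^sub>R f x) = f"
    using assms(3) by (force simp: indicator_def)
  ultimately show int: "integrable lborel f" by simp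
  have e: "(\<lambda>x. indicator \<Omega> x * f x) = f"
    using assms(3,4) by (force simp: indicator_def)
  have b: "f \<in> borel_measurable lborel"
    using assms(1) by (simp add: borel_measurable_continuous_onI)
  show "(LINT x|lebesgue_on \<Omega>. f x) = (LINT x|lborel. f x)"
    using assms(5) b by (subst integral_restrict_space) (auto simp: e integral_completion)
  show "integrable (lebesgue_on \<Omega>) f"
    using assms(5) b int by (subst integrable_restrict_space) (auto simp: e integrable_completion)
qed

lemma exp_inv_0_le_1: "exp_inv 0 t \<le> 1" "0 \<le> exp_inv k t"
  by (auto simp: exp_inv_def)

lemma exp_inv_eq_0_iff: "exp_inv k t = 0 \<longleftrightarrow> t \<le> 0"
  by (auto simp: exp_inv_def)

text \<open>A zero integral would make the nonempty open set where \<open>f\<close> is nonzero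
  negligible.\<close>

lemma integral_open_support_pos:
  fixes f :: "real^3 \<Rightarrow> real"
  assumes "continuous_on UNIV f" "integrable lborel f" "\<And>x. 0 \<le> f x" "f y \<noteq> 0"
  shows "0 < (LINT x|lborel. f x)"
proof -
  have "(LINT x|lborel. f x) \<noteq> 0"
  proof
    assume "(LINT x|lborel. f x) = 0"
    then have "AE x in lborel. f x = 0"
      using assms(2,3) by (subst (asm) integral_nonneg_eq_0_iff_AE) auto
    then have "AE x in lebesgue. f x = 0" by (rule AE_completion)
    then have "negligible {x. f x \<noteq> 0}"
      by (simp add: negligible_iff_null_sets completion.AE_iff_null_sets)
    moreover have "open {x. f x \<noteq> 0}"
      using open_Collect_neq[OF assms(1) continuous_on_const] by simp
    ultimately show False using assms(4) open_not_negligible by blast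
  qed
  moreover have "0 \<le> (LINT x|lborel. f x)" using assms(3) by simp
  ultimately show ?thesis by simp
qed

text \<open>On a set of finite measure \<open>1 + t^2\<close> is an integrable majorant of
  \<open>\<bar>t\<bar>\<close>. This supplies the dominating function for the limit of the squeezed
  bumps.\<close>

lemma L2_imp_integrable:
  fixes g :: "real^3 \<Rightarrow> real"
  assumes "g \<in> L2 \<Omega>" "\<Omega> \<in> lmeasurable"
  shows "integrable (lebesgue_on \<Omega>) g"
proof -
  interpret finite_measure "lebesgue_on \<Omega>"
    using assms(2) by (rule finite_measure_lebesgue_on)
  show ?thesis
  proof (rule Bochner_Integration.integrable_bound)
    show "integrable (lebesgue_on \<Omega>) (\<lambda>x. 1 + (norm (g x))\<^sup>2)"
      using assms by (auto simp: L2_def)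
    have "norm t \<le> norm (1 + (norm t)\<^sup>2)" for t :: real
      using sum_squares_bound[of 1 "\<bar>t\<bar>"] by simp
    then show "AE x in lebesgue_on \<Omega>. norm (g x) \<le> norm (1 + (norm (g x))\<^sup>2)" by simp
  qed (use assms in \<open>auto simp: L2_def\<close>)
qed

text \<open>Test the weak derivative \<open>g\<close> with bumps centred on the face \<open>x\<^sub>i = 0\<close> and squeezed by a factor \<open>k\<close>
  in direction \<open>i\<close>. The integral of \<open>\<bar>\<partial>\<^sub>i \<phi>\<bar>\<close> does not depend on \<open>k\<close>, so the contribution of a jump stays
  bounded away from zero, whereas the integral of \<open>g \<phi>\<close> vanishes as \<open>k\<close> grows.\<close>

lemma H1_no_jump:
  fixes v :: "real^3 \<Rightarrow> real" and s :: "real^3"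
  assumes v: "v \<in> H1 \<Omega>" and \<Omega>: "open \<Omega>" "\<Omega> \<in> lmeasurable" "{x. (\<Sum>m\<in>UNIV. \<bar>x $ m\<bar>) < 1} \<subseteq> \<Omega>"
    and s: "\<And>m. \<bar>s $ m\<bar> = 1"
    and c: "\<And>x. (\<Sum>m\<in>UNIV. \<bar>x $ m\<bar>) < 1 \<Longrightarrow> (\<And>m. m \<noteq> i \<Longrightarrow> s $ m * x $ m > 0) \<Longrightarrow> s $ i * x $ i > 0 \<Longrightarrow>
      v x = c * (1 - (\<Sum>m\<in>UNIV. \<bar>x $ m\<bar>))"
    and c': "\<And>x. (\<Sum>m\<in>UNIV. \<bar>x $ m\<bar>) < 1 \<Longrightarrow> (\<And>m. m \<noteq> i \<Longrightarrow> s $ m * x $ m > 0) \<Longrightarrow> s $ i * x $ i < 0 \<Longrightarrow>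
      v x = c' * (1 - (\<Sum>m\<in>UNIV. \<bar>x $ m\<bar>))"
  shows "c = c'"
proof -
  define L :: "real^3 \<Rightarrow> real" where "L x = (\<Sum>m\<in>UNIV. \<bar>x $ m\<bar>)" for x
  \<comment> \<open>The centre lies on the face \<open>x $ i = 0\<close>, at distance 1/4 from the
    other two coordinate planes on the side of \<open>s\<close>. With radius 1/8, whose square is
    1/64, the support avoids those planes and, as 1/8 + 3/8 + 3/8 = 7/8, stays inside the
    octahedron.\<close>
  define p :: "real^3" where "p = (\<chi> m. if m = i then 0 else s $ m / 4)"
  define a :: "real \<Rightarrow> 3 \<Rightarrow> real" where "a k m = (if m = i then k else 1)" for k m
  define B where "B k x = 1/64 - (\<Sum>m\<in>UNIV. (a k m * x $ m - p $ m)\<^sup>2)" for k and x :: "real^3"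
  define \<phi> where "\<phi> k x = exp_inv 0 (B k x)" for k x
  \<comment> \<open>\<open>D k\<close> will be the partial derivative of \<open>\<phi> k\<close> in
    direction \<open>i\<close>, and \<open>P k\<close> is its absolute value. Index 2 arises because
    the derivative of \<open>exp_inv 0\<close> is \<open>exp_inv 2\<close>.\<close>
  define P where "P k x = exp_inv 2 (B k x) * (2 * k\<^sup>2 * \<bar>x $ i\<bar>)" for k x
  define D where "D k x = - exp_inv 2 (B k x) * (2 * k\<^sup>2 * x $ i)" for k x
  \<comment> \<open>A single box that contains the supports for all \<open>k\<close> from 1
    on.\<close>
  define K where "K = {x. \<forall>m. \<bar>x $ m - p $ m\<bar> \<le> 1/8}"
  have K_box: "K = cbox (p - vec (1/8)) (p + vec (1/8))"
  proof -
    have "\<bar>x $ m - p $ m\<bar> \<le> 1/8 \<longleftrightarrow> p $ m - 1/8 \<le> x $ m \<and> x $ m \<le> p $ m + 1/8" for x m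
      by linarith
    then show ?thesis by (simp add: K_def set_eq_iff mem_box_cart)
  qed
  then have K_compact: "compact K" by simp
  have in_K: "x \<in> K" if "B k x > 0" "k \<ge> 1" for k x
    unfolding K_def
  proof safe
    fix m
    have "(a k m * x $ m - p $ m)\<^sup>2 \<le> (\<Sum>m\<in>UNIV. (a k m * x $ m - p $ m)\<^sup>2)"
      by (rule member_le_sum) auto
    with that have "(a k m * x $ m - p $ m)\<^sup>2 < (1/8)\<^sup>2" by (simp add: B_def power2_eq_square)
    then have h: "\<bar>a k m * x $ m - p $ m\<bar> < 1/8"
      by (metis abs_le_square_iff abs_of_pos linorder_not_less zero_less_divide_1_iff zero_less_numeral)
    show "\<bar>x $ m - p $ m\<bar> \<le> 1/8"
    proof (cases "m = i")
      case True
      \<comment> \<open>Squeezing about \<open>p $ i = 0\<close> only shrinks the support in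
        direction \<open>i\<close>.\<close>
      have "1 * \<bar>x $ i\<bar> \<le> k * \<bar>x $ i\<bar>" using that by (intro mult_right_mono) auto
      with h True that show ?thesis by (simp add: a_def p_def abs_mult)
    qed (use h in \<open>simp add: a_def\<close>)
  qed
  have K_sgn: "s $ m * x $ m > 0" if "x \<in> K" "m \<noteq> i" for x m
    using that s[of m] unfolding K_def p_def
    by (auto simp: abs_if split: if_splits dest!: spec[of _ m])
  have K_L: "L x \<le> 7/8" if "x \<in> K" for x
  proof -
    have b: "\<bar>x $ m\<bar> \<le> (if m = i then 1/8 else 3/8)" for m
      using that s[of m] unfolding K_def p_def
      by (auto simp: abs_if split: if_splits dest!: spec[of _ m])
    have "L x \<le> (\<Sum>m\<in>UNIV. (if m = i then 1/8 else 3/8))"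
      unfolding L_def by (rule sum_mono) (rule b)
    also have "\<dots> = (7/8::real)" using exhaust_3[of i] by (auto simp: sum_3)
    finally show ?thesis .
  qed
  have K_\<Omega>: "K \<subseteq> \<Omega>"
  proof
    fix x assume "x \<in> K"
    then have "L x < 1" using K_L[of x] by simp
    then show "x \<in> \<Omega>" using \<Omega>(3) by (auto simp: L_def)
  qed
  have cont_B: "continuous_on UNIV (B k)" for k
    unfolding B_def by (intro continuous_intros)
  have cont_e: "continuous_on UNIV (\<lambda>x. exp_inv j (B k x))" for j k
    using continuous_on_compose2[OF exp_inv_continuous cont_B] by auto
  have cont_L: "continuous_on UNIV L"
    unfolding L_def by (intro continuous_intros)
  have B_der: "(B k has_derivative (\<lambda>h. - (\<Sum>m\<in>UNIV. 2 * (a k m * x $ m - p $ m) * (a k m * h $ m)))) (at x)"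
    for k x
    unfolding B_def
    by (auto intro!: derivative_eq_intros bounded_linear_imp_has_derivative[OF bounded_linear_vec_nth]
      simp: algebra_simps sum_negf)
  have partial_\<phi>: "partial i (\<phi> k) x = D k x" for k x
  proof -
    have "(\<Sum>m\<in>UNIV. 2 * (a k m * x $ m - p $ m) * (a k m * axis i 1 $ m)) = 2 * k\<^sup>2 * x $ i"
      by (subst sum.remove[of _ i]) (auto simp: a_def p_def axis_def power2_eq_square)
    then show ?thesis
      unfolding \<phi>_def
      by (subst partial_eq[OF exp_inv_has_derivative_compose[OF B_der]]) (simp add: D_def numeral_2_eq_2)
  qed
  have B_smooth: "B k \<in> smooth_class" for k
  proof -
    have "B k = (\<lambda>x. 1/64 + (-1) * (\<Sum>m\<in>UNIV. (a k m * x $ m + (- p $ m)) * (a k m * x $ m + (- p $ m))))"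
      by (auto simp: B_def power2_eq_square)
    also have "\<dots> \<in> smooth_class"
      by (intro smooth_class.add smooth_class.mult smooth_class_sum smooth_class.const
          smooth_class.coord) auto
    finally show ?thesis .
  qed
  have test: "test_function \<Omega> (\<phi> k)" if "k \<ge> 1" for k
  proof -
    have "{x. \<phi> k x \<noteq> 0} \<subseteq> K"
      using in_K that by (auto simp: \<phi>_def exp_inv_eq_0_iff not_le)
    then have cl: "closure {x. \<phi> k x \<noteq> 0} \<subseteq> K"
      using K_compact by (simp add: closure_minimal compact_imp_closed)
    moreover have "compact (closure {x. \<phi> k x \<noteq> 0})"
      using cl K_compact by (metis closed_closure compact_Int_closed inf.absorb_iff2)
    moreover have "smooth (\<phi> k)"
      unfolding \<phi>_def by (intro smooth_class_smooth smooth_class.exp_inv B_smooth)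
    ultimately show ?thesis using K_\<Omega> by (auto simp: test_function_def)
  qed
  obtain g where g: "g \<in> L2 \<Omega>" and weak: "\<And>\<phi>. test_function \<Omega> \<phi> \<Longrightarrow>
     (LINT x|lebesgue_on \<Omega>. v x * partial i \<phi> x) = - (LINT x|lebesgue_on \<Omega>. g x * \<phi> x)"
    using v unfolding H1_def by blast
  have cont_P: "continuous_on UNIV (P k)" and cont_D: "continuous_on UNIV (D k)" for k
    unfolding P_def D_def by (intro continuous_intros cont_e)+
  have P_0: "P k x = 0" and D_0: "D k x = 0" if "x \<notin> K" "k \<ge> 1" for x k
    using in_K that by (force simp: P_def D_def exp_inv_eq_0_iff)+
  \<comment> \<open>The product of \<open>v\<close> and \<open>D k\<close> will be split into a
    multiple of \<open>G k\<close>, odd in coordinate \<open>i\<close>, and a multiple of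
    \<open>H k\<close>, even in it. The first integrates to 0, the second carries the jump
    \<open>c - c'\<close>.\<close>
  define G where "G k x = (1 - L x) * D k x" for k x
  define H where "H k x = (1 - L x) * P k x" for k x
  note on = integral_lebesgue_on_continuous[OF _ K_compact _ K_\<Omega> \<Omega>(1)]
  have P_int: "integrable lborel (P k)" if "k \<ge> 1" for k
    by (rule on(1)) (use cont_P P_0 that in auto)
  have cont_G: "continuous_on UNIV (G k)" and cont_H: "continuous_on UNIV (H k)" for k
    unfolding G_def H_def by (intro continuous_intros cont_P cont_D cont_L)+
  have G_0: "G k x = 0" and H_0: "H k x = 0" if "x \<notin> K" "k \<ge> 1" for x k
    using that P_0 D_0 by (auto simp: G_def H_def)
  \<comment> \<open>\<open>G k\<close> is odd in \<open>x\<^sub>i\<close>\<close>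
  have int_G: "(LINT x|lborel. G k x) = 0" for k
  proof -
    have "G k (\<chi> m. if m = i then (-1) * x $ m else x $ m) = - G k x" for x
    proof -
      have "L (\<chi> m. if m = i then (-1) * x $ m else x $ m) = L x"
        unfolding L_def by (rule sum.cong) auto
      moreover have "B k (\<chi> m. if m = i then (-1) * x $ m else x $ m) = B k x"
        unfolding B_def by (intro arg_cong2[where f = minus] sum.cong refl) (auto simp: a_def p_def power2_eq_square)
      ultimately show ?thesis by (simp add: G_def D_def)
    qed
    then have "(LINT x|lborel. G k x) = - (LINT x|lborel. G k x)"
      using lborel_integral_stretch[of "G k" "-1" i] cont_G
      by (simp add: borel_measurable_continuous_onI)
    then show ?thesis by simp
  qed
  \<comment> \<open>The factor \<open>k\<close> gained by the derivative offsets the volume factor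
    \<open>1 / k\<close> of the squeezing.\<close>
  have int_P: "(LINT x|lborel. P k x) = (LINT x|lborel. P 1 x)" if "k \<ge> 1" for k
  proof -
    have "k * P 1 (\<chi> m. if m = i then k * x $ m else x $ m) = P k x" for x
    proof -
      have "B 1 (\<chi> m. if m = i then k * x $ m else x $ m) = B k x"
        unfolding B_def by (intro arg_cong2[where f = minus] sum.cong refl) (auto simp: a_def)
      then show ?thesis using that by (simp add: P_def abs_mult power2_eq_square)
    qed
    moreover have "(LINT x|lborel. P 1 x) =
        (LINT x|lborel. k * P 1 (\<chi> m. if m = i then k * x $ m else x $ m))"
      using lborel_integral_stretch[of "P 1" k i] cont_P that
      by (simp add: borel_measurable_continuous_onI)
    ultimately show ?thesis by simp
  qed
  have pos: "0 < (LINT x|lborel. P 1 x)"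
  proof (rule integral_open_support_pos)
    \<comment> \<open>The witness is moved off the face, where \<open>P 1\<close> vanishes, by 1/16,
      which is less than the radius 1/8.\<close>
    have "B 1 (p + axis i (1/16)) = 1/64 - (\<Sum>m\<in>UNIV. (axis i (1/16) $ m)\<^sup>2)"
      unfolding B_def by (intro arg_cong2[where f = minus] sum.cong refl) (auto simp: a_def)
    also have "\<dots> = 1/64 - (1/16)\<^sup>2"
      by (subst sum.remove[of _ i]) (auto simp: axis_def)
    also have "\<dots> > 0" by (simp add: power2_eq_square)
    finally show "P 1 (p + axis i (1/16)) \<noteq> 0"
      by (auto simp: P_def exp_inv_eq_0_iff p_def axis_def)
    show "P 1 x \<ge> 0" for x by (simp add: P_def exp_inv_0_le_1)
  qed (use cont_P P_int in auto)
  \<comment> \<open>On \<open>K\<close> the weight \<open>1 - L x\<close> is at least 1/8, by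
    \<open>K_L\<close>.\<close>
  have H_ge: "(LINT x|lborel. P 1 x) / 8 \<le> (LINT x|lborel. H k x)" if "k \<ge> 1" for k
  proof -
    have "P k x / 8 \<le> H k x" for x
    proof (cases "x \<in> K")
      case True
      have "1/8 * P k x \<le> (1 - L x) * P k x"
        using K_L[OF True] by (intro mult_right_mono) (auto simp: P_def exp_inv_0_le_1)
      then show ?thesis by (simp add: H_def)
    qed (use P_0 H_0 that in auto)
    moreover have "integrable lborel (H k)"
      by (rule on(1)) (use cont_H H_0 that in auto)
    ultimately have "(LINT x|lborel. P k x / 8) \<le> (LINT x|lborel. H k x)"
      using P_int[OF that] by (intro integral_mono) auto
    then show ?thesis using int_P[OF that] by simp
  qed
  \<comment> \<open>The term \<open>s $ i * H k x\<close> equals \<open>- G k x\<close> on the side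
    of \<open>s\<close> and \<open>G k x\<close> on the other, so the right-hand side is
    \<open>c * G k x\<close> or \<open>c' * G k x\<close> respectively. On the face itself
    everything vanishes with \<open>D k\<close>, whatever value \<open>v\<close> takes
    there.\<close>
  have jump: "v x * D k x = (c + c') / 2 * G k x - (c - c') / 2 * s $ i * H k x" if "k \<ge> 1" for x k
  proof (cases "x \<in> K")
    case True
    have L1: "L x < 1" using K_L[OF True] by simp
    have vx: "s $ i * x $ i > 0 \<Longrightarrow> v x = c * (1 - L x)" "s $ i * x $ i < 0 \<Longrightarrow> v x = c' * (1 - L x)"
      using c[of x] c'[of x] L1 K_sgn[OF True] unfolding L_def by blast+
    have si: "s $ i = 1 \<or> s $ i = -1" using s[of i] by linarith
    have as: "(c - c') / 2 * s $ i * H k x = (c - c') / 2 * (s $ i * H k x)" by (simp only: mult.assoc)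
    consider "x $ i = 0" | "s $ i * x $ i > 0" | "s $ i * x $ i < 0"
      using si by fastforce
    then show ?thesis
    proof cases
      case 1
      then show ?thesis by (simp add: D_def G_def H_def P_def)
    next
      case 2
      have e1: "s $ i * H k x = - G k x"
      proof -
        have "\<bar>x $ i\<bar> = s $ i * x $ i" using si 2 by auto
        then show ?thesis using si by (elim disjE) (simp_all add: H_def G_def D_def P_def)
      qed
      have e2: "v x * D k x = c * G k x" by (simp add: vx(1)[OF 2] G_def)
      show ?thesis unfolding as e1 e2 by (simp add: field_simps)
    next
      case 3
      have e1: "s $ i * H k x = G k x"
      proof -
        have "\<bar>x $ i\<bar> = - (s $ i * x $ i)" using si 3 by auto
        then show ?thesis using si by (elim disjE) (simp_all add: H_def G_def D_def P_def)
      qed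
      have e2: "v x * D k x = c' * G k x" by (simp add: vx(2)[OF 3] G_def)
      show ?thesis unfolding as e1 e2 by (simp add: field_simps)
    qed
  qed (use that G_0 H_0 D_0 in auto)
  have main: "\<bar>c - c'\<bar> / 2 * ((LINT x|lborel. P 1 x) / 8) \<le> \<bar>LINT x|lebesgue_on \<Omega>. g x * \<phi> k x\<bar>"
    if "k \<ge> 1" for k
  proof -
    have "(LINT x|lebesgue_on \<Omega>. v x * partial i (\<phi> k) x) =
        (c + c') / 2 * (LINT x|lebesgue_on \<Omega>. G k x) - (c - c') / 2 * s $ i * (LINT x|lebesgue_on \<Omega>. H k x)"
      using on(2)[of "G k"] on(2)[of "H k"] cont_G cont_H G_0 H_0 that
      by (simp add: partial_\<phi> jump)
    also have "\<dots> = - ((c - c') / 2 * s $ i * (LINT x|lborel. H k x))"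
      using on(3)[of "G k"] on(3)[of "H k"] cont_G cont_H G_0 H_0 that int_G by simp
    finally have "(LINT x|lebesgue_on \<Omega>. g x * \<phi> k x) = (c - c') / 2 * s $ i * (LINT x|lborel. H k x)"
      using weak[OF test[OF that]] by simp
    then have "\<bar>LINT x|lebesgue_on \<Omega>. g x * \<phi> k x\<bar> = \<bar>c - c'\<bar> / 2 * \<bar>LINT x|lborel. H k x\<bar>"
      by (simp only: abs_mult abs_divide s abs_numeral mult_1_right)
    moreover have "\<bar>c - c'\<bar> / 2 * ((LINT x|lborel. P 1 x) / 8) \<le> \<bar>c - c'\<bar> / 2 * \<bar>LINT x|lborel. H k x\<bar>"
      using H_ge[OF that] by (intro mult_left_mono) auto
    ultimately show ?thesis by (simp only:)
  qed
  \<comment> \<open>Since \<open>\<phi>\<close> takes values in [0, 1], \<open>\<bar>g\<bar>\<close>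
    dominates. The index \<open>Suc n\<close> keeps the squeezing factor at least 1.\<close>
  have lim: "(\<lambda>n. LINT x|lebesgue_on \<Omega>. g x * \<phi> (real (Suc n)) x) \<longlonglongrightarrow> (LINT x|lebesgue_on \<Omega>. 0)"
  proof (rule integral_dominated_convergence)
    show "integrable (lebesgue_on \<Omega>) (\<lambda>x. \<bar>g x\<bar>)"
      using L2_imp_integrable[OF g \<Omega>(2)] by auto
    have m: "g \<in> borel_measurable (lebesgue_on \<Omega>)" using g by (simp add: L2_def)
    have "\<phi> k \<in> borel_measurable (lebesgue_on \<Omega>)" for k
      unfolding \<phi>_def
      by (intro measurable_restrict_space1 measurable_completion)
        (simp add: borel_measurable_continuous_onI cont_e)
    with m show "(\<lambda>x. g x * \<phi> (real (Suc n)) x) \<in> borel_measurable (lebesgue_on \<Omega>)" for n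
      by simp
    show "AE x in lebesgue_on \<Omega>. norm (g x * \<phi> (real (Suc n)) x) \<le> \<bar>g x\<bar>" for n
      by (auto simp: \<phi>_def abs_mult exp_inv_0_le_1 intro!: mult_left_le)
    have "negligible {x::real^3. x $ i = 0}"
      by (rule negligible_standard_hyperplane_cart)
    then have "AE x in lebesgue. (x::real^3) $ i \<noteq> 0"
      by (simp add: negligible_iff_null_sets completion.AE_iff_null_sets)
    then have ae: "AE x in lebesgue_on \<Omega>. x $ i \<noteq> 0"
      using \<Omega>(1) by (subst AE_restrict_space_iff) auto
    show "AE x in lebesgue_on \<Omega>. (\<lambda>n. g x * \<phi> (real (Suc n)) x) \<longlonglongrightarrow> 0"
      using ae
    proof eventually_elim
      case (elim x)
      \<comment> \<open>A point with \<open>x $ i\<close> nonzero leaves the support eventually: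
        \<open>B\<close> positive forces \<open>(k * x $ i)^2 < 1/64\<close>, hence less than 1,
        which fails once \<open>k * \<bar>x $ i\<bar>\<close> exceeds 1.\<close>
      obtain N where N: "real N * \<bar>x $ i\<bar> > 1" using elim reals_Archimedean3[of "\<bar>x $ i\<bar>"] by auto
      have "\<phi> (real (Suc n)) x = 0" if "n \<ge> N" for n
      proof -
        have "\<not> B (real (Suc n)) x > 0"
        proof
          assume "B (real (Suc n)) x > 0"
          moreover have "(a (real (Suc n)) i * x $ i - p $ i)\<^sup>2 \<le>
              (\<Sum>m\<in>UNIV. (a (real (Suc n)) m * x $ m - p $ m)\<^sup>2)"
            by (rule member_le_sum) auto
          ultimately have "(real (Suc n) * x $ i)\<^sup>2 < 1" by (simp add: B_def a_def p_def)
          then have "real (Suc n) * \<bar>x $ i\<bar> < 1" by (simp add: abs_square_less_1 abs_mult)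
          moreover have "real N * \<bar>x $ i\<bar> \<le> real (Suc n) * \<bar>x $ i\<bar>"
            using that by (intro mult_right_mono) auto
          ultimately show False using N by simp
        qed
        then show ?thesis by (simp add: \<phi>_def exp_inv_eq_0_iff)
      qed
      then show ?case
        by (intro tendsto_eventually) (auto simp: eventually_sequentially)
    qed
  qed simp
  have "\<bar>c - c'\<bar> / 2 * ((LINT x|lborel. P 1 x) / 8) \<le> \<bar>LINT x|lebesgue_on \<Omega>. 0::real\<bar>"
    by (rule LIMSEQ_le_const[OF tendsto_rabs[OF lim]]) (use main in auto)
  then have "\<bar>c - c'\<bar> * (LINT x|lborel. P 1 x) \<le> 0" by simp
  with pos show ?thesis by (simp add: mult_le_0_iff)
qed

section \<open>Geometry of the octahedron\<close>

text \<open>Elements are indexed by the sign vector \<open>s\<close> of their octant; \<open>Tet j k l\<close> belongs to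
  \<open>s = ((-1)\<^sup>j, (-1)\<^sup>k, (-1)\<^sup>l)\<close>.\<close>

definition signs :: "(real^3) set" where
  "signs = {s. \<forall>m. s $ m = 1 \<or> s $ m = -1}"

definition tet :: "real^3 \<Rightarrow> (real^3) set" where
  "tet s = convex hull {0, s $ 1 *\<^sub>R axis 1 1, s $ 2 *\<^sub>R axis 2 1, s $ 3 *\<^sub>R axis 3 1}"

text \<open>On sign vectors this moves from an element to its neighbour across the plane
  \<open>x $ i = 0\<close>.\<close>

definition flip :: "3 \<Rightarrow> real^3 \<Rightarrow> real^3" where
  "flip i s = (\<chi> m. if m = i then - s $ m else s $ m)"

lemma signs_flip: "s \<in> signs \<Longrightarrow> flip i s \<in> signs"
  by (auto simp: signs_def flip_def)

lemma signs_abs: "s \<in> signs \<Longrightarrow> \<bar>s $ m\<bar> = 1"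
  by (auto simp: signs_def dest!: spec[of _ m])

lemma signs_mult_self: "s \<in> signs \<Longrightarrow> s $ m * s $ m = 1"
  by (auto simp: signs_def dest!: spec[of _ m])

lemma vector_3_eq_iff:
  "(vector [a, b, c] :: real^3) = vector [x, y, z] \<longleftrightarrow> a = x \<and> b = y \<and> c = z"
  by (auto simp: vec_eq_iff forall_3)

lemma signs_eq:
  "signs = {vector [1, 1, 1], vector [1, 1, -1], vector [1, -1, 1], vector [1, -1, -1],
     vector [-1, 1, 1], vector [-1, 1, -1], vector [-1, -1, 1], vector [-1, -1, -1]}"
proof -
  have "x \<in> signs \<longleftrightarrow> x \<in> {vector [1, 1, 1], vector [1, 1, -1], vector [1, -1, 1], vector [1, -1, -1],
     vector [-1, 1, 1], vector [-1, 1, -1], vector [-1, -1, 1], vector [-1, -1, -1]}" for x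
  proof -
    obtain a b c where x: "x = vector [a, b, c]"
      using forall_vector_3[of "\<lambda>x. \<exists>a b c. x = vector [a, b, c]"] by blast
    show ?thesis unfolding x by (auto simp: signs_def forall_3 vector_3_eq_iff)
  qed
  then show ?thesis by blast
qed

lemma finite_signs: "finite signs"
  by (simp add: signs_eq)

lemma sum_signs:
  "(\<Sum>s\<in>signs. f s) = f (vector [1, 1, 1]) + f (vector [1, 1, -1]) + f (vector [1, -1, 1]) +
     f (vector [1, -1, -1]) + f (vector [-1, 1, 1]) + f (vector [-1, 1, -1]) +
     f (vector [-1, -1, 1]) + (f (vector [-1, -1, -1]) :: real)"
  by (simp add: signs_eq vector_3_eq_iff)

lemma flip_vector:
  "flip 1 (vector [a, b, c]) = vector [-a, b, c]"
  "flip 2 (vector [a, b, c]) = vector [a, -b, c]"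
  "flip 3 (vector [a, b, c]) = vector [a, b, -c]"
  by (auto simp: flip_def vec_eq_iff forall_3)

section \<open>Elements as images of the standard simplex\<close>

lemma linear_times_vec: "linear ((*) (s :: real^3))"
  by (rule linearI) (auto simp: vec_eq_iff algebra_simps)

lemma signs_times: "s \<in> signs \<Longrightarrow> s * (s * x) = x"
  by (simp add: vec_eq_iff signs_mult_self flip: mult.assoc)

text \<open>The product on \<open>real^3\<close> is componentwise, so a sign vector acts as a
  composition of coordinate reflections and is its own inverse. Membership, interior and volume can
  thus be read off the standard simplex.\<close>

lemma tet_eq: "tet s = (*) s ` (convex hull (insert 0 Basis))"
proof -
  have B: "Basis = {axis 1 1, axis 2 1, axis 3 1 :: real^3}"
    by (auto simp: Basis_vec_def UNIV_3)
  have m: "s * axis m 1 = s $ m *\<^sub>R axis m 1" for m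
    by (simp add: vec_eq_iff axis_def)
  have z: "s * 0 = 0" by (simp add: vec_eq_iff)
  show ?thesis
    unfolding tet_def convex_hull_linear_image[OF linear_times_vec] B image_insert image_empty m z ..
qed

lemma in_image_times: "s \<in> signs \<Longrightarrow> x \<in> (*) s ` A \<longleftrightarrow> s * x \<in> A"
  using signs_times by (metis image_iff)

lemma std_simplex_cart:
  "(convex hull (insert 0 Basis) :: (real^3) set) = {x. (\<forall>m. 0 \<le> x $ m) \<and> (\<Sum>m\<in>UNIV. x $ m) \<le> 1}"
  "interior (convex hull (insert 0 Basis) :: (real^3) set) = {x. (\<forall>m. 0 < x $ m) \<and> (\<Sum>m\<in>UNIV. x $ m) < 1}"
  unfolding interior_std_simplex unfolding std_simplex
  by (simp_all add: Basis_vec_def UNION_singleton_eq_range inner_axis sum.reindex inj_on_def axis_eq_axis)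

lemma mem_tet:
  "s \<in> signs \<Longrightarrow> x \<in> tet s \<longleftrightarrow> (\<forall>m. 0 \<le> s $ m * x $ m) \<and> (\<Sum>m\<in>UNIV. s $ m * x $ m) \<le> 1"
  by (simp add: tet_eq in_image_times std_simplex_cart(1))

lemma interior_tet_eq: "s \<in> signs \<Longrightarrow> interior (tet s) = (*) s ` interior (convex hull (insert 0 Basis))"
  unfolding tet_eq
  by (rule interior_injective_linear_image) (auto simp: linear_times_vec inj_def dest: signs_times, metis signs_times)

lemma mem_interior_tet:
  "s \<in> signs \<Longrightarrow> x \<in> interior (tet s) \<longleftrightarrow> (\<forall>m. 0 < s $ m * x $ m) \<and> (\<Sum>m\<in>UNIV. s $ m * x $ m) < 1"
  by (simp add: interior_tet_eq in_image_times std_simplex_cart(2))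

lemma sum_signs_mult_eq_abs:
  assumes "s \<in> signs" "\<And>m. 0 \<le> s $ m * x $ m"
  shows "(\<Sum>m\<in>UNIV. s $ m * x $ m) = (\<Sum>m\<in>UNIV. \<bar>x $ m\<bar>)"
proof (rule sum.cong)
  show "s $ m * x $ m = \<bar>x $ m\<bar>" for m
    using assms(2)[of m] signs_abs[OF assms(1), of m] by (metis abs_mult abs_of_nonneg mult_1)
qed simp

lemma Tet_eq_tet: "Tet j k l = tet (vector [(-1) ^ j, (-1) ^ k, (-1) ^ l])"
  by (simp add: Tet_def tet_def)

lemma octa_eq: "octa = tet ` signs"
proof -
  have "octa = {tet (vector [(-1) ^ j, (-1) ^ k, (-1) ^ l]) | j k l.
      j \<in> {1, 2::nat} \<and> k \<in> {1, 2::nat} \<and> l \<in> {1, 2::nat}}"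
    by (simp add: octa_def Tet_eq_tet)
  also have "\<dots> = (\<Union>j\<in>{1, 2}. \<Union>k\<in>{1, 2}. \<Union>l\<in>{1, 2}.
      {tet (vector [(-1) ^ j, (-1) ^ k, (-1) ^ l])})"
    by blast
  also have "\<dots> = tet ` signs" by (auto simp: signs_eq)
  finally show ?thesis .
qed

section \<open>The octahedron as a ball of the l1 norm, and its boundary\<close>

lemma Union_octa: "\<Union>octa = {x. (\<Sum>m\<in>UNIV. \<bar>x $ m\<bar>) \<le> 1}"
proof (intro equalityI subsetI)
  fix x assume "x \<in> \<Union>octa"
  then obtain s where "s \<in> signs" "x \<in> tet s" by (auto simp: octa_eq)
  then show "x \<in> {x. (\<Sum>m\<in>UNIV. \<bar>x $ m\<bar>) \<le> 1}"
    using sum_signs_mult_eq_abs[of s x] by (simp add: mem_tet)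
next
  fix x :: "real^3" assume x: "x \<in> {x. (\<Sum>m\<in>UNIV. \<bar>x $ m\<bar>) \<le> 1}"
  \<comment> \<open>At a zero coordinate either sign would do; 1 is chosen.\<close>
  define s :: "real^3" where "s = (\<chi> m. if x $ m \<ge> 0 then 1 else -1)"
  have s: "s \<in> signs" "\<And>m. 0 \<le> s $ m * x $ m" by (auto simp: signs_def s_def)
  then have "x \<in> tet s" using x sum_signs_mult_eq_abs[OF s] by (simp add: mem_tet)
  with s show "x \<in> \<Union>octa" by (auto simp: octa_eq)
qed

lemma open_domain: "open (domain \<T>)"
  by (simp add: domain_def)

lemma l1_ball_subset_domain: "{x. (\<Sum>m\<in>UNIV. \<bar>x $ m\<bar>) < 1} \<subseteq> domain octa"
  unfolding domain_def Union_octa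
  by (rule interior_maximal) (auto intro!: open_Collect_less continuous_intros)

lemma domain_lmeasurable: "domain octa \<in> lmeasurable"
proof (rule bounded_set_imp_lmeasurable)
  have "bounded (\<Union>octa)"
    unfolding octa_eq tet_def using finite_signs
    by (intro bounded_UN ballI bounded_convex_hull finite_imp_bounded) auto
  then show "bounded (domain octa)"
    unfolding domain_def by (rule bounded_subset) (rule interior_subset)
qed (simp add: open_domain)

text \<open>Radial scaling decides both halves: the points \<open>(1 + 1/n) x\<close> lie outside
  the octahedron, the points \<open>(1 - 1/n) x\<close> in the open l1 ball, and both sequences tend
  to \<open>x\<close>.\<close>

lemma l1_sphere_subset_frontier:
  assumes "(\<Sum>m\<in>UNIV. \<bar>x $ m\<bar>) = 1"
  shows "x \<in> frontier (domain octa)"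
proof -
  have l1: "(\<Sum>m\<in>UNIV. \<bar>(t *\<^sub>R x) $ m\<bar>) = \<bar>t\<bar>" for t
    using assms by (simp add: abs_mult flip: sum_distrib_left)
  have "x \<notin> domain octa"
  proof
    assume "x \<in> domain octa"
    have "(\<lambda>n. (1 + 1 / real (Suc n)) *\<^sub>R x) \<longlonglongrightarrow> (1 + 0) *\<^sub>R x"
      by (intro tendsto_intros LIMSEQ_Suc[OF lim_1_over_n])
    then have "eventually (\<lambda>n. (1 + 1 / real (Suc n)) *\<^sub>R x \<in> domain octa) sequentially"
      using \<open>x \<in> domain octa\<close> open_domain by (intro topological_tendstoD[where l = x]) auto
    then obtain n where "(1 + 1 / real (Suc n)) *\<^sub>R x \<in> domain octa"
      by (meson eventually_happens' sequentially_bot)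
    then have "(1 + 1 / real (Suc n)) *\<^sub>R x \<in> \<Union>octa"
      unfolding domain_def using interior_subset by blast
    then have "\<bar>1 + 1 / real (Suc n)\<bar> \<le> 1"
      unfolding Union_octa mem_Collect_eq l1 .
    moreover have "1 / real (Suc n) > 0" by simp
    ultimately show False by linarith
  qed
  moreover have "x \<in> closure (domain octa)"
    unfolding closure_sequential
  proof (intro exI conjI allI)
    fix n
    have "\<bar>1 - 1 / real (Suc n)\<bar> < 1" by (simp add: abs_if field_simps)
    then have "(1 - 1 / real (Suc n)) *\<^sub>R x \<in> {x. (\<Sum>m\<in>UNIV. \<bar>x $ m\<bar>) < 1}"
      unfolding mem_Collect_eq l1 .
    then show "(1 - 1 / real (Suc n)) *\<^sub>R x \<in> domain octa"
      using l1_ball_subset_domain by blast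
  next
    have "(\<lambda>n. (1 - 1 / real (Suc n)) *\<^sub>R x) \<longlonglongrightarrow> (1 - 0) *\<^sub>R x"
      by (intro tendsto_intros LIMSEQ_Suc[OF lim_1_over_n])
    then show "(\<lambda>n. (1 - 1 / real (Suc n)) *\<^sub>R x) \<longlonglongrightarrow> x" by simp
  qed
  ultimately show ?thesis by (simp add: frontier_def open_domain interior_open)
qed

section \<open>Volumes and integrals over the elements\<close>

lemma convex_tet: "convex (tet s)"
  by (simp add: tet_def)

lemma interior_tet_nonempty: "s \<in> signs \<Longrightarrow> interior (tet s) \<noteq> {}"
  using interior_std_simplex_nonempty interior_tet_eq by (metis empty_iff image_is_empty)

lemma interior_tet_subset_domain: "s \<in> signs \<Longrightarrow> interior (tet s) \<subseteq> domain octa"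
  unfolding domain_def by (rule interior_mono) (auto simp: octa_eq)

lemma interior_tet_disjoint:
  assumes "s \<in> signs" "t \<in> signs" "x \<in> interior (tet s)" "x \<in> interior (tet t)"
  shows "s = t"
proof -
  have "s $ m = t $ m" for m
  proof -
    have "s $ m * x $ m > 0" "t $ m * x $ m > 0" using assms by (auto simp: mem_interior_tet)
    then show ?thesis using assms(1,2)[unfolded signs_def] by (auto dest!: spec[of _ m])
  qed
  then show ?thesis by (simp add: vec_eq_iff)
qed

text \<open>The common volume is kept symbolic: the arguments rest on its positivity and on its
  being the same for all eight elements.\<close>

definition tet_volume :: real where
  "tet_volume = measure lebesgue (interior (convex hull (insert 0 (Basis :: (real^3) set))))"

lemma lmeasurable_interior_simplex: "interior (convex hull (insert 0 (Basis :: (real^3) set))) \<in> lmeasurable"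
  by (intro bounded_set_imp_lmeasurable bounded_interior bounded_convex_hull finite_imp_bounded) auto

lemma tet_volume_pos: "tet_volume > 0"
proof -
  have "\<not> negligible (interior (convex hull (insert 0 (Basis :: (real^3) set))))"
    using interior_std_simplex_nonempty open_not_negligible by (metis empty_iff open_interior)
  then show ?thesis
    using lmeasurable_interior_simplex
    by (simp add: tet_volume_def negligible_iff_measure zero_less_measure_iff)
qed

text \<open>Componentwise multiplication by a sign vector is orthogonal, hence preserves Lebesgue
  measure.\<close>

lemma measure_interior_tet:
  assumes "s \<in> signs"
  shows "interior (tet s) \<in> lmeasurable" "measure lebesgue (interior (tet s)) = tet_volume"
proof -
  have "orthogonal_transformation ((*) s)"
    unfolding orthogonal_transformation_def
  proof (intro conjI allI linear_times_vec)
    have "s $ m * v $ m * (s $ m * w $ m) = v $ m * w $ m" for v w :: "real^3" and m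
      using signs_mult_self[OF assms, of m] by (metis mult.assoc mult.left_commute mult_1)
    then show "(s * v) \<bullet> (s * w) = v \<bullet> w" for v w
      unfolding inner_vec_def vector_mult_component inner_real_def by (intro sum.cong refl)
  qed
  then show "interior (tet s) \<in> lmeasurable" "measure lebesgue (interior (tet s)) = tet_volume"
    unfolding interior_tet_eq[OF assms] tet_volume_def
    by (intro measurable_orthogonal_image measure_orthogonal_image lmeasurable_interior_simplex; assumption)+
qed

text \<open>The exceptional points lie on the frontiers of finitely many convex sets, which are
  negligible.\<close>

lemma AE_interior_tet: "AE x in lebesgue. x \<in> domain octa \<longrightarrow> (\<exists>s\<in>signs. x \<in> interior (tet s))"
proof -
  have "negligible (\<Union>s\<in>signs. frontier (tet s))"
    using finite_signs by (intro negligible_Union) (auto intro: negligible_convex_frontier convex_tet)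
  then have "AE x in lebesgue. x \<notin> (\<Union>s\<in>signs. frontier (tet s))"
    using AE_not_in negligible_iff_null_sets by blast
  then show ?thesis
  proof eventually_elim
    case (elim x)
    show ?case
    proof
      assume "x \<in> domain octa"
      then obtain s where s: "s \<in> signs" "x \<in> tet s"
        unfolding domain_def using interior_subset by (force simp: octa_eq)
      with elim have "x \<in> interior (tet s)"
        using closure_subset by (auto simp: frontier_def)
      with s show "\<exists>s\<in>signs. x \<in> interior (tet s)" by blast
    qed
  qed
qed

text \<open>The values of \<open>f\<close> on the faces are unconstrained, so even its measurability
  is derived: \<open>f\<close> agrees almost everywhere with a sum of indicators, and Lebesgue
  measure is complete.\<close>

lemma integral_piecewise_const:
  fixes f :: "real^3 \<Rightarrow> real"
  assumes f: "\<And>s x. s \<in> signs \<Longrightarrow> x \<in> interior (tet s) \<Longrightarrow> f x = k s"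
  shows "integrable (lebesgue_on (domain octa)) f"
    "(LINT x|lebesgue_on (domain octa). f x) = tet_volume * (\<Sum>s\<in>signs. k s)"
proof -
  define h where "h x = (\<Sum>s\<in>signs. indicator (interior (tet s)) x * k s)" for x
  have ae: "AE x in lebesgue. h x = indicator (domain octa) x *\<^sub>R f x"
    using AE_interior_tet
  proof eventually_elim
    case (elim x)
    show ?case
    proof (cases "x \<in> domain octa")
      case True
      with elim obtain s where s: "s \<in> signs" "x \<in> interior (tet s)" by blast
      have "h x = (\<Sum>t\<in>{s}. indicator (interior (tet t)) x * k t)"
        unfolding h_def
        by (rule sum.mono_neutral_right) (use finite_signs s interior_tet_disjoint in \<open>auto simp: indicator_def\<close>)
      with s True f show ?thesis by simp
    next
      case False
      then show ?thesis
        using interior_tet_subset_domain by (force simp: h_def indicator_def intro!: sum.neutral)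
    qed
  qed
  have int: "integrable lebesgue h"
    unfolding h_def using measure_interior_tet(1)
    by (intro Bochner_Integration.integrable_sum integrable_mult_left) (auto simp: fmeasurable_def)
  have m: "(\<lambda>x. indicator (domain octa) x *\<^sub>R f x) \<in> borel_measurable lebesgue"
    by (rule borel_measurable_AE[OF borel_measurable_integrable[OF int] ae])
  have i: "integrable lebesgue (\<lambda>x. indicator (domain octa) x *\<^sub>R f x)"
    by (rule integrable_cong_AE_imp[OF int m ae])
  have e: "integral\<^sup>L lebesgue h = integral\<^sup>L lebesgue (\<lambda>x. indicator (domain octa) x *\<^sub>R f x)"
    by (rule integral_cong_AE[OF borel_measurable_integrable[OF int] m ae])
  have [simp]: "domain octa \<in> sets lebesgue" by (simp add: open_domain)
  show "integrable (lebesgue_on (domain octa)) f" using i by (simp add: integrable_restrict_space)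
  have "integral\<^sup>L lebesgue h = (\<Sum>s\<in>signs. measure lebesgue (interior (tet s)) * k s)"
    unfolding h_def using measure_interior_tet(1)
    by (subst Bochner_Integration.integral_sum) (auto simp: fmeasurable_def)
  also have "\<dots> = tet_volume * (\<Sum>s\<in>signs. k s)"
    unfolding sum_distrib_left by (intro sum.cong refl) (simp only: measure_interior_tet(2))
  finally show "(LINT x|lebesgue_on (domain octa). f x) = tet_volume * (\<Sum>s\<in>signs. k s)"
    using e by (simp add: integral_restrict_space)
qed

section \<open>Finite element functions on the octahedron\<close>

lemma sum_signs_mult_eq_inner: "(\<Sum>m\<in>UNIV. s $ m * x $ m) = s \<bullet> (x :: real^3)"
  by (simp add: inner_vec_def)

text \<open>Every point of a convex set with nonempty interior is a limit point of that interior, so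
  the limit behind \<open>elem_trace\<close> is unique and follows from the continuity of the affine
  formula.\<close>

lemma elem_trace_affine:
  assumes v: "\<And>y. y \<in> interior T \<Longrightarrow> v y = a \<bullet> y + b"
    and T: "convex T" "interior T \<noteq> {}" "x \<in> T"
  shows "elem_trace T v x = a \<bullet> x + b"
proof -
  have "x \<in> closure (interior T)"
    using T closure_subset by (auto simp: convex_closure_interior)
  then have "x islimpt interior T"
    by (metis closure_def UnE mem_Collect_eq interior_limit_point interior_interior)
  then have "\<not> trivial_limit (at x within interior T)"
    by (simp add: trivial_limit_within)
  moreover have "((\<lambda>y. a \<bullet> y + b) \<longlongrightarrow> a \<bullet> x + b) (at x within interior T)"
    by (intro tendsto_intros)
  then have "(v \<longlongrightarrow> a \<bullet> x + b) (at x within interior T)"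
    by (rule Lim_transform_eventually) (auto simp: eventually_at_filter v)
  ultimately show ?thesis unfolding elem_trace_def by (intro tendsto_Lim)
qed

lemma partial_h_affine:
  assumes "\<And>y. y \<in> interior (tet s) \<Longrightarrow> v y = a \<bullet> y + b" "s \<in> signs" "x \<in> interior (tet s)"
  shows "partial_h octa i v x = a $ i"
proof -
  have "((\<lambda>y. a \<bullet> y + b) has_derivative (\<lambda>h. a \<bullet> h)) (at x)"
    by (auto intro!: derivative_eq_intros)
  then have "(v has_derivative (\<lambda>h. a \<bullet> h)) (at x)"
    by (rule has_derivative_transform_within_open[OF _ open_interior]) (use assms in auto)
  then have "partial i v x = a \<bullet> axis i 1" by (rule partial_eq)
  then show ?thesis using assms by (auto simp: partial_h_def octa_eq inner_axis)
qed

text \<open>The three vertices of the element other than the origin lie on the boundary. The zero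
  trace at vertex \<open>i\<close> fixes \<open>a $ i\<close> in terms of \<open>b\<close>, which
  leaves only the value at the origin free.\<close>

lemma SC_octa_form:
  assumes v: "v \<in> SC octa (frontier (domain octa))" and s: "s \<in> signs"
  obtains c where "\<And>x. x \<in> interior (tet s) \<Longrightarrow> v x = c * (1 - s \<bullet> x)"
proof -
  have "affine_on_element (tet s) v" using v s by (auto simp: SC_def octa_eq)
  then obtain a b where ab: "\<And>x. x \<in> interior (tet s) \<Longrightarrow> v x = a \<bullet> x + b"
    unfolding affine_on_element_def by blast
  have "a $ i = - b * s $ i" for i
  proof -
    define x :: "real^3" where "x = s $ i *\<^sub>R axis i 1"
    have nth: "x $ m = (if m = i then s $ i else 0)" for m
      by (auto simp: x_def axis_def)
    have "x \<in> tet s"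
      using s signs_mult_self[OF s, of i]
      by (auto simp: mem_tet nth if_distrib cong: if_cong)
    moreover have "x \<in> frontier (domain octa)"
      by (rule l1_sphere_subset_frontier) (simp add: nth if_distrib signs_abs[OF s] cong: if_cong)
    ultimately have "elem_trace (tet s) v x = 0" using v s by (auto simp: SC_def octa_eq)
    moreover have "elem_trace (tet s) v x = a \<bullet> x + b"
      by (rule elem_trace_affine[OF ab convex_tet interior_tet_nonempty[OF s] \<open>x \<in> tet s\<close>])
    moreover have "a \<bullet> x = s $ i * a $ i" by (simp add: x_def inner_axis)
    ultimately have "s $ i * a $ i = - b" by simp
    then have "s $ i * s $ i * a $ i = - b * s $ i"
      by (metis mult.assoc mult.commute)
    then show ?thesis by (simp add: signs_mult_self[OF s])
  qed
  then have "a = - b *\<^sub>R s" by (simp add: vec_eq_iff)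
  with ab have "v x = b * (1 - s \<bullet> x)" if "x \<in> interior (tet s)" for x
    using that by (simp add: algebra_simps)
  then show thesis by (rule that)
qed

text \<open>\<open>H1_no_jump\<close> equates the coefficients of elements that share a face in a
  coordinate plane, and any two sign vectors are connected by flips.\<close>

lemma SC_octa_coefficient:
  assumes v: "v \<in> SC octa (frontier (domain octa))"
  obtains c where "\<And>s x. s \<in> signs \<Longrightarrow> x \<in> interior (tet s) \<Longrightarrow> v x = c * (1 - s \<bullet> x)"
proof -
  have "\<forall>s\<in>signs. \<exists>c. \<forall>x \<in> interior (tet s). v x = c * (1 - s \<bullet> x)"
    using SC_octa_form[OF v] by metis
  then obtain c where c: "\<And>s x. s \<in> signs \<Longrightarrow> x \<in> interior (tet s) \<Longrightarrow> v x = c s * (1 - s \<bullet> x)"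
    by metis
  have H1: "v \<in> H1 (domain octa)" using v by (simp add: SC_def)
  \<comment> \<open>Inside an octant \<open>s \<bullet> x\<close> is the l1 norm of
    \<open>x\<close>; this puts both one-sided formulas into the common form of
    \<open>H1_no_jump\<close>.\<close>
  have c_abs: "v x = c s * (1 - (\<Sum>m\<in>UNIV. \<bar>x $ m\<bar>))"
    if "s \<in> signs" "(\<Sum>m\<in>UNIV. \<bar>x $ m\<bar>) < 1" "\<And>m. s $ m * x $ m > 0" for s x
  proof -
    have e: "(\<Sum>m\<in>UNIV. s $ m * x $ m) = (\<Sum>m\<in>UNIV. \<bar>x $ m\<bar>)"
      by (rule sum_signs_mult_eq_abs) (use that in \<open>auto intro: less_imp_le\<close>)
    with that have "x \<in> interior (tet s)" by (simp add: mem_interior_tet)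
    from c[OF that(1) this] e show ?thesis by (simp add: sum_signs_mult_eq_inner)
  qed
  have flip: "c s = c (flip i s)" if s: "s \<in> signs" for s i
  proof (rule H1_no_jump[OF H1 open_domain domain_lmeasurable l1_ball_subset_domain])
    show "\<bar>s $ m\<bar> = 1" for m by (rule signs_abs[OF s])
    show "v x = c s * (1 - (\<Sum>m\<in>UNIV. \<bar>x $ m\<bar>))"
      if "(\<Sum>m\<in>UNIV. \<bar>x $ m\<bar>) < 1" "\<And>m. m \<noteq> i \<Longrightarrow> s $ m * x $ m > 0" "s $ i * x $ i > 0" for x
      by (rule c_abs) (use s that in \<open>metis+\<close>)
    show "v x = c (flip i s) * (1 - (\<Sum>m\<in>UNIV. \<bar>x $ m\<bar>))"
      if "(\<Sum>m\<in>UNIV. \<bar>x $ m\<bar>) < 1" "\<And>m. m \<noteq> i \<Longrightarrow> s $ m * x $ m > 0" "s $ i * x $ i < 0" for x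
      by (rule c_abs) (use s signs_flip that in \<open>auto simp: flip_def\<close>)
  qed
  have "c s = c (vector [1, 1, 1])" if "s \<in> signs" for s
  proof -
    have m: "vector [x, y, z] \<in> signs" if "x \<in> {1, -1}" "y \<in> {1, -1}" "z \<in> {1, -1}" for x y z :: real
      using that by (auto simp: signs_def forall_3)
    have 1: "c (vector [-1, y, z]) = c (vector [1, y, z])" if "y \<in> {1, -1}" "z \<in> {1, -1}" for y z
      using flip[of "vector [1, y, z]" 1] m that by (simp add: flip_vector)
    have 2: "c (vector [x, -1, z]) = c (vector [x, 1, z])" if "x \<in> {1, -1}" "z \<in> {1, -1}" for x z
      using flip[of "vector [x, 1, z]" 2] m that by (simp add: flip_vector)
    have 3: "c (vector [x, y, -1]) = c (vector [x, y, 1])" if "x \<in> {1, -1}" "y \<in> {1, -1}" for x y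
      using flip[of "vector [x, y, 1]" 3] m that by (simp add: flip_vector)
    show ?thesis using that unfolding signs_eq by (auto simp: 1 2 3)
  qed
  then show thesis using c that by metis
qed

section \<open>Face integrals and nonconforming functions\<close>

abbreviation vertex :: "real^3 \<Rightarrow> 3 \<Rightarrow> real^3" where
  "vertex s i \<equiv> s $ i *\<^sub>R axis i 1"

lemma reference_triangle:
  defines "D \<equiv> {(s, t). 0 \<le> s \<and> 0 \<le> t \<and> s + t \<le> (1::real)}"
  shows "compact D" "measure lebesgue D > 0"
proof -
  have "closed D"
    unfolding D_def case_prod_beta
    by (intro closed_Collect_conj closed_Collect_le continuous_intros)
  moreover have "D \<subseteq> cbox (0, 0) (1, 1)" by (auto simp: D_def cbox_Pair_eq)
  ultimately show "compact D" by (metis bounded_cbox bounded_subset compact_eq_bounded_closed)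
  then have "D \<in> lmeasurable" by (rule lmeasurable_compact)
  moreover have "\<not> negligible D"
  proof
    assume "negligible D"
    \<comment> \<open>The triangle contains an open square of side 1/2.\<close>
    then have "negligible ({0<..<1/2::real} \<times> {0<..<1/2::real})"
      by (rule negligible_subset) (auto simp: D_def)
    then show False using open_not_negligible[of "{0<..<1/2::real} \<times> {0<..<1/2::real}"]
      by (simp add: open_Times Sigma_empty_iff)
  qed
  ultimately show "measure lebesgue D > 0"
    by (simp add: negligible_iff_measure zero_less_measure_iff)
qed

lemma triangle_param_in_hull:
  fixes a b c :: "real^3"
  assumes "0 \<le> s" "0 \<le> t" "s + t \<le> 1"
  shows "a + s *\<^sub>R (b - a) + t *\<^sub>R (c - a) \<in> convex hull {a, b, c}"
proof -
  have "a + s *\<^sub>R (b - a) + t *\<^sub>R (c - a) = (1 - s - t) *\<^sub>R a + s *\<^sub>R b + t *\<^sub>R c"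
    by (simp add: algebra_simps)
  also have "\<dots> \<in> convex hull {a, b, c}"
    unfolding convex_hull_3 mem_Collect_eq using assms
    by (intro exI[of _ "1 - s - t"] exI[of _ s] exI[of _ t]) auto
  finally show ?thesis .
qed

text \<open>Adding the integrals for the three cyclic orders of the vertices makes the integrand constant,
  so that no moment of the reference triangle has to be computed.\<close>

lemma triangle_integral_zero_imp_vertex_sum_zero:
  assumes f: "\<And>x. x \<in> convex hull {a, b, c} \<Longrightarrow> f x = \<alpha> \<bullet> x + \<beta>"
    and cross: "cross3 (b - a) (c - a) \<noteq> 0"
    and zero: "triangle_integral a b c f = 0" "triangle_integral b c a f = 0" "triangle_integral c a b f = 0"
  shows "\<alpha> \<bullet> (a + b + c) + 3 * \<beta> = 0"
proof -
  define D where "D = {(s, t). 0 \<le> s \<and> 0 \<le> t \<and> s + t \<le> (1::real)}"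
  have D: "compact D" "measure lebesgue D > 0" using reference_triangle by (auto simp: D_def)
  have Ds: "D \<in> sets lebesgue" using D(1) by (simp add: compact_imp_closed)
  define I where "I a b c = (\<lambda>y. \<alpha> \<bullet> (a + fst y *\<^sub>R (b - a) + snd y *\<^sub>R (c - a)) + \<beta>)" for a b c and y :: "real \<times> real"
  have int: "integrable (lebesgue_on D) (I a b c)" for a b c
  proof -
    have "continuous_on D (I a b c)" unfolding I_def by (intro continuous_intros)
    then have "integrable lborel (\<lambda>y. indicator D y *\<^sub>R I a b c y)"
      by (rule borel_integrable_compact[OF D(1)])
    then have "integrable lebesgue (\<lambda>y. indicator D y *\<^sub>R I a b c y)"
      by (subst integrable_completion) auto
    then show ?thesis using Ds by (simp add: integrable_restrict_space)
  qed
  have I: "(LINT y|lebesgue_on D. I p q r y) = 0"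
    if "triangle_integral p q r f = 0" "{p, q, r} = {a, b, c}" "cross3 (q - p) (r - p) \<noteq> 0" for p q r
  proof -
    have "f (p + fst y *\<^sub>R (q - p) + snd y *\<^sub>R (r - p)) = I p q r y" if "y \<in> D" for y
    proof -
      have "p + fst y *\<^sub>R (q - p) + snd y *\<^sub>R (r - p) \<in> convex hull {p, q, r}"
        using \<open>y \<in> D\<close> by (intro triangle_param_in_hull) (auto simp: D_def)
      then have "p + fst y *\<^sub>R (q - p) + snd y *\<^sub>R (r - p) \<in> convex hull {a, b, c}"
        unfolding \<open>{p, q, r} = {a, b, c}\<close> .
      then show ?thesis unfolding I_def by (rule f)
    qed
    then have "(LINT y|lebesgue_on D. f (p + fst y *\<^sub>R (q - p) + snd y *\<^sub>R (r - p))) = (LINT y|lebesgue_on D. I p q r y)"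
      by (intro Bochner_Integration.integral_cong) auto
    with that show ?thesis by (simp add: triangle_integral_def D_def)
  qed
  \<comment> \<open>A cyclic change of the vertices preserves the cross product, so the nonzero area
    factor can be cancelled in all three integrals.\<close>
  have cyc: "cross3 (c - b) (a - b) = cross3 (b - a) (c - a)" "cross3 (a - c) (b - c) = cross3 (b - a) (c - a)"
    by (simp_all add: cross3_def vec_eq_iff forall_3 algebra_simps)
  have "(LINT y|lebesgue_on D. I a b c y) = 0" by (rule I[OF zero(1) refl cross])
  moreover have "(LINT y|lebesgue_on D. I b c a y) = 0"
    by (rule I[OF zero(2)]) (use cross cyc in auto)
  moreover have "(LINT y|lebesgue_on D. I c a b y) = 0"
    by (rule I[OF zero(3)]) (use cross cyc in auto)
  ultimately have "(LINT y|lebesgue_on D. I a b c y + I b c a y + I c a b y) = 0"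
    using int by (simp only: Bochner_Integration.integral_add Bochner_Integration.integrable_add add_0)
  \<comment> \<open>At parameters \<open>(s, t)\<close> each vertex receives the weights
    \<open>1 - s - t\<close>, \<open>s\<close> and \<open>t\<close> once, which add up to 1.\<close>
  moreover have "(\<lambda>y. I a b c y + I b c a y + I c a b y) = (\<lambda>_. \<alpha> \<bullet> (a + b + c) + 3 * \<beta>)"
    unfolding I_def by (simp add: fun_eq_iff algebra_simps)
  ultimately have "measure (lebesgue_on D) (space (lebesgue_on D)) *\<^sub>R (\<alpha> \<bullet> (a + b + c) + 3 * \<beta>) = 0"
    by (simp only: lebesgue_integral_const)
  moreover have "measure (lebesgue_on D) (space (lebesgue_on D)) = measure lebesgue D"
    using Ds by (subst measure_restrict_space) (auto simp: space_restrict_space)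
  ultimately have "measure lebesgue D *\<^sub>R (\<alpha> \<bullet> (a + b + c) + 3 * \<beta>) = 0" by (simp only:)
  with D(2) show ?thesis unfolding scaleR_eq_0_iff by linarith
qed

text \<open>The three vertices other than 0 are nonzero and pairwise orthogonal. Affine independence
  is what identifies the facets by omission of a vertex.\<close>

lemma tet_affine_independent:
  assumes "s \<in> signs"
  shows "\<not> affine_dependent {0, vertex s 1, vertex s 2, vertex s 3}"
proof -
  have nz: "s $ i \<noteq> 0" for i using signs_abs[OF assms, of i] by auto
  have "independent {vertex s 1, vertex s 2, vertex s 3}"
    by (rule pairwise_orthogonal_independent)
      (auto simp: pairwise_def orthogonal_def inner_axis_axis nz axis_eq_0_iff)
  moreover have "0 \<notin> {vertex s 1, vertex s 2, vertex s 3}"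
    by (auto simp: nz axis_eq_0_iff)
  ultimately show ?thesis by (subst affine_dependent_iff_dependent) auto
qed

lemma vertex_distinct:
  assumes "s \<in> signs" "i \<noteq> j"
  shows "vertex s i \<noteq> vertex s j" "vertex s i \<noteq> 0" "0 \<noteq> vertex s i"
proof -
  have nz: "s $ i \<noteq> 0" for i using signs_abs[OF assms(1), of i] by auto
  have "vertex s i $ i \<noteq> vertex s j $ i" using nz assms(2) by (simp add: axis_def)
  then show "vertex s i \<noteq> vertex s j" by metis
  show "vertex s i \<noteq> 0" "0 \<noteq> vertex s i" using nz by (auto simp: axis_eq_0_iff)
qed

text \<open>Omitting the origin gives the outer face, omitting the third vertex the face in the
  plane \<open>x $ 3 = 0\<close>.\<close>

lemma tet_facets:
  assumes "s \<in> signs"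
  shows "convex hull {vertex s 1, vertex s 2, vertex s 3} facet_of tet s"
    "convex hull {0, vertex s 1, vertex s 2} facet_of tet s"
proof -
  note d = vertex_distinct[OF assms]
  have e: "{0, vertex s 1, vertex s 2, vertex s 3} - {0} = {vertex s 1, vertex s 2, vertex s 3}"
    "{0, vertex s 1, vertex s 2, vertex s 3} - {vertex s 3} = {0, vertex s 1, vertex s 2}"
    using d[of 1 2] d[of 1 3] d[of 2 3] d[of 3 1] by auto
  have "convex hull ({0, vertex s 1, vertex s 2, vertex s 3} - {u}) facet_of tet s"
    if "u \<in> {0, vertex s 1, vertex s 2, vertex s 3}"
      "convex hull ({0, vertex s 1, vertex s 2, vertex s 3} - {u}) \<noteq> {}" for u
    unfolding tet_def facet_of_convex_hull_affine_independent[OF tet_affine_independent[OF assms]]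
    using that by blast
  from this[of 0] this[of "vertex s 3"]
  show "convex hull {vertex s 1, vertex s 2, vertex s 3} facet_of tet s"
    "convex hull {0, vertex s 1, vertex s 2} facet_of tet s"
    unfolding e by simp_all
qed

lemma SNC_interior_face:
  assumes "v \<in> SNC \<T> \<Gamma>" "T \<in> \<T>" "T' \<in> \<T>" "T \<noteq> T'"
    "convex hull {a, b, c} facet_of T" "convex hull {a, b, c} facet_of T'"
  shows "triangle_integral a b c (\<lambda>x. elem_trace T v x - elem_trace T' v x) = 0"
  using assms unfolding SNC_def by blast

lemma SNC_boundary_face:
  assumes "v \<in> SNC \<T> \<Gamma>" "T \<in> \<T>" "convex hull {a, b, c} facet_of T" "convex hull {a, b, c} \<subseteq> \<Gamma>"
  shows "triangle_integral a b c (elem_trace T v) = 0"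
  using assms unfolding SNC_def by blast

text \<open>A zero mean of an affine function on a triangle means that its vertex values sum to
  zero. The outer faces give
  \<open>s $ 1 * a $ 1 + s $ 2 * a $ 2 + s $ 3 * a $ 3 + 3 * b = 0\<close> and its analogue for the
  neighbour; the shared face makes the sums without the third term agree. Subtraction leaves the
  third terms, whose signs are opposite.\<close>

lemma SNC_octa_slope:
  assumes v: "v \<in> SNC octa (frontier (domain octa))" and s: "s \<in> signs"
    and a: "\<And>x. x \<in> interior (tet s) \<Longrightarrow> v x = a \<bullet> x + b"
    and a': "\<And>x. x \<in> interior (tet (flip 3 s)) \<Longrightarrow> v x = a' \<bullet> x + b'"
  shows "a' $ 3 = - a $ 3"
proof -
  define s' where "s' = flip 3 s"
  have s': "s' \<in> signs" using s by (simp add: s'_def signs_flip)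
  have s'_nth: "s' $ 1 = s $ 1" "s' $ 2 = s $ 2" "s' $ 3 = - s $ 3"
    by (auto simp: s'_def flip_def)
  have nz: "s $ i \<noteq> 0" for i using signs_abs[OF s, of i] by auto
  \<comment> \<open>Stated for a general \<open>t\<close>, so that it applies to both
    \<open>s\<close> and its neighbour \<open>s'\<close>.\<close>
  have outer: "t $ 1 * w $ 1 + t $ 2 * w $ 2 + t $ 3 * w $ 3 + 3 * d = 0"
    if t: "t \<in> signs" and w: "\<And>x. x \<in> interior (tet t) \<Longrightarrow> v x = w \<bullet> x + d" for t w d
  proof -
    let ?F = "convex hull {vertex t 1, vertex t 2, vertex t 3}"
    have nzt: "t $ i \<noteq> 0" for i using signs_abs[OF t, of i] by auto
    have sub: "?F \<subseteq> tet t" unfolding tet_def by (rule hull_mono) auto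
    have "?F \<subseteq> {x. t \<bullet> x = 1}"
      by (rule hull_minimal) (auto simp: convex_hyperplane inner_axis signs_mult_self[OF t])
    have bd: "?F \<subseteq> frontier (domain octa)"
    proof
      fix x assume x: "x \<in> ?F"
      then have "x \<in> tet t" "t \<bullet> x = 1" using sub \<open>?F \<subseteq> {x. t \<bullet> x = 1}\<close> by auto
      then have "(\<Sum>m\<in>UNIV. \<bar>x $ m\<bar>) = 1"
        using sum_signs_mult_eq_abs[OF t, of x] mem_tet[OF t] by (simp add: sum_signs_mult_eq_inner)
      then show "x \<in> frontier (domain octa)" by (rule l1_sphere_subset_frontier)
    qed
    \<comment> \<open>The face conditions in \<open>SNC\<close> range over all orderings of the
      vertices of a face, which provides the three cyclic integrals.\<close>
    have z: "triangle_integral p q r (elem_trace (tet t) v) = 0"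
      if "{p, q, r} = {vertex t 1, vertex t 2, vertex t 3}" for p q r
      using tet_facets(1)[OF t] bd t by (intro SNC_boundary_face[OF v]) (simp_all add: that octa_eq)
    have "w \<bullet> (vertex t 1 + vertex t 2 + vertex t 3) + 3 * d = 0"
    proof (rule triangle_integral_zero_imp_vertex_sum_zero)
      show "elem_trace (tet t) v x = w \<bullet> x + d" if "x \<in> ?F" for x
        by (rule elem_trace_affine[OF w convex_tet interior_tet_nonempty[OF t]]) (use that sub in auto)
      have "cross3 (vertex t 2 - vertex t 1) (vertex t 3 - vertex t 1) $ 1 = t $ 2 * t $ 3"
        by (simp add: cross3_def axis_def)
      then show "cross3 (vertex t 2 - vertex t 1) (vertex t 3 - vertex t 1) \<noteq> 0"
        using nzt by (metis mult_eq_0_iff zero_index)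
    qed (rule z; auto)+
    then show ?thesis by (simp add: inner_add_right inner_axis)
  qed
  have "(a - a') \<bullet> (0 + vertex s 1 + vertex s 2) + 3 * (b - b') = 0"
  proof -
    let ?F = "convex hull {0, vertex s 1, vertex s 2}"
    \<comment> \<open>The flip changes only the third sign, so the two elements share the vertices
      0, 1 and 2.\<close>
    have "?F = convex hull {0, vertex s' 1, vertex s' 2}" by (simp add: s'_nth)
    then have facet: "?F facet_of tet s" "?F facet_of tet s'"
      using tet_facets(2)[OF s] tet_facets(2)[OF s'] by simp_all
    have sub: "?F \<subseteq> tet s" "?F \<subseteq> tet s'"
      using facet by (auto simp: facet_of_imp_subset subset_iff dest: facet_of_imp_subset)
    have "tet s \<noteq> tet s'"
    proof
      assume "tet s = tet s'"
      then have "s = s'" using interior_tet_disjoint[OF s s'] interior_tet_nonempty[OF s] by auto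
      then show False using s'_nth(3) nz[of 3] by simp
    qed
    have z: "triangle_integral p q r (\<lambda>x. elem_trace (tet s) v x - elem_trace (tet s') v x) = 0"
      if "{p, q, r} = {0, vertex s 1, vertex s 2}" for p q r
      using \<open>tet s \<noteq> tet s'\<close> facet s s'
      by (intro SNC_interior_face[OF v]) (simp_all add: that octa_eq)
    show ?thesis
    proof (rule triangle_integral_zero_imp_vertex_sum_zero)
      show "elem_trace (tet s) v x - elem_trace (tet s') v x = (a - a') \<bullet> x + (b - b')" if "x \<in> ?F" for x
      proof -
        have "x \<in> tet s" "x \<in> tet s'" using that sub by blast+
        then have "elem_trace (tet s) v x = a \<bullet> x + b" "elem_trace (tet s') v x = a' \<bullet> x + b'"
          using elem_trace_affine[OF a convex_tet interior_tet_nonempty[OF s]]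
            elem_trace_affine[OF a'[folded s'_def] convex_tet interior_tet_nonempty[OF s']] by blast+
        then show ?thesis by (simp add: inner_diff_left)
      qed
      have "cross3 (vertex s 1 - 0) (vertex s 2 - 0) $ 3 = s $ 1 * s $ 2"
        by (simp add: cross3_def axis_def)
      then show "cross3 (vertex s 1 - 0) (vertex s 2 - 0) \<noteq> 0"
        using nz by (metis mult_eq_0_iff zero_index)
    qed (rule z; auto)+
  qed
  then have "s $ 1 * a $ 1 + s $ 2 * a $ 2 + 3 * b = s $ 1 * a' $ 1 + s $ 2 * a' $ 2 + 3 * b'"
    by (simp add: inner_add_right inner_axis algebra_simps)
  moreover note outer[OF s a] outer[OF s' a'[folded s'_def]]
  ultimately have "s $ 3 * a $ 3 = s' $ 3 * a' $ 3" by (simp add: s'_nth)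
  then have "s $ 3 * (a $ 3 + a' $ 3) = 0" by (simp add: s'_nth algebra_simps)
  then show ?thesis using nz[of 3] by simp
qed

section \<open>Spurious pressure modes\<close>

text \<open>The expression \<open>(1 + s $ 1 * s $ 2) / 2\<close> encodes \<open>qt\<close>: it is 1
  if the first two signs agree and 0 otherwise, independently of the third.\<close>

lemma velocity_div_orthogonal:
  assumes v: "v \<in> velocities octa (frontier (domain octa))"
    and q: "\<And>s x. s \<in> signs \<Longrightarrow> x \<in> interior (tet s) \<Longrightarrow> q x = (1 + s $ 1 * s $ 2) / 2 - c"
  shows "(LINT x|lebesgue_on (domain octa). q x * div_h octa v x) = 0"
proof -
  obtain c1 where c1: "\<And>s x. s \<in> signs \<Longrightarrow> x \<in> interior (tet s) \<Longrightarrow> v x $ 1 = c1 * (1 - s \<bullet> x)"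
    using SC_octa_coefficient[of "\<lambda>x. v x $ 1"] v by (auto simp: velocities_def)
  obtain c2 where c2: "\<And>s x. s \<in> signs \<Longrightarrow> x \<in> interior (tet s) \<Longrightarrow> v x $ 2 = c2 * (1 - s \<bullet> x)"
    using SC_octa_coefficient[of "\<lambda>x. v x $ 2"] v by (auto simp: velocities_def)
  have v3: "(\<lambda>x. v x $ 3) \<in> SNC octa (frontier (domain octa))"
    using v by (simp add: velocities_def)
  then have "\<forall>s\<in>signs. \<exists>a b. \<forall>x\<in>interior (tet s). v x $ 3 = a \<bullet> x + b"
    by (auto simp: SNC_def octa_eq affine_on_element_def)
  then obtain a b where ab: "\<And>s x. s \<in> signs \<Longrightarrow> x \<in> interior (tet s) \<Longrightarrow> v x $ 3 = a s \<bullet> x + b s"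
    by metis
  have flip: "a (flip 3 s) $ 3 = - a s $ 3" if "s \<in> signs" for s
    by (rule SNC_octa_slope[OF v3 that]) (use ab that signs_flip in auto)
  \<comment> \<open>Expressing the slopes below the plane \<open>x $ 3 = 0\<close> by those above
    makes the final sum over eight elements a polynomial identity.\<close>
  have a3: "a (vector [y, z, -1]) $ 3 = - a (vector [y, z, 1]) $ 3" if "y \<in> {1, -1}" "z \<in> {1, -1}" for y z
    using flip[of "vector [y, z, 1]"] that by (auto simp: flip_vector signs_def forall_3)
  have div: "div_h octa v x = - c1 * s $ 1 - c2 * s $ 2 + a s $ 3"
    if s: "s \<in> signs" and x: "x \<in> interior (tet s)" for s x
  proof -
    have "partial_h octa 1 (\<lambda>y. v y $ 1) x = (- c1 *\<^sub>R s) $ 1"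
      by (rule partial_h_affine[OF _ s x, of _ _ c1]) (subst c1[OF s], simp_all add: algebra_simps)
    moreover have "partial_h octa 2 (\<lambda>y. v y $ 2) x = (- c2 *\<^sub>R s) $ 2"
      by (rule partial_h_affine[OF _ s x, of _ _ c2]) (subst c2[OF s], simp_all add: algebra_simps)
    moreover have "partial_h octa 3 (\<lambda>y. v y $ 3) x = a s $ 3"
      by (rule partial_h_affine[OF _ s x]) (rule ab[OF s])
    ultimately show ?thesis by (simp add: div_h_def sum_3)
  qed
  have "(LINT x|lebesgue_on (domain octa). q x * div_h octa v x) = tet_volume *
      (\<Sum>s\<in>signs. ((1 + s $ 1 * s $ 2) / 2 - c) * (- c1 * s $ 1 - c2 * s $ 2 + a s $ 3))"
    by (rule integral_piecewise_const(2)) (simp add: q div)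
  also have "\<dots> = 0"
    by (simp add: sum_signs a3 algebra_simps)
  finally show ?thesis .
qed

lemma pressures_piecewise_const:
  assumes p: "\<And>s x. s \<in> signs \<Longrightarrow> x \<in> interior (tet s) \<Longrightarrow> p x = k s"
  shows "p \<in> pressures octa"
    "L2norm (domain octa) p = sqrt (tet_volume * (\<Sum>s\<in>signs. (k s)\<^sup>2))"
proof -
  have "integrable (lebesgue_on (domain octa)) p"
    using p by (rule integral_piecewise_const(1))
  moreover have "integrable (lebesgue_on (domain octa)) (\<lambda>x. (norm (p x))\<^sup>2)"
    by (rule integral_piecewise_const(1)[where k = "\<lambda>s. (k s)\<^sup>2"]) (simp add: p)
  ultimately show "p \<in> pressures octa"
    using p by (auto simp: pressures_def L2_def octa_eq)
  have "(LINT x|lebesgue_on (domain octa). (norm (p x))\<^sup>2) = tet_volume * (\<Sum>s\<in>signs. (k s)\<^sup>2)"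
    by (rule integral_piecewise_const(2)) (simp add: p)
  then show "L2norm (domain octa) p = sqrt (tet_volume * (\<Sum>s\<in>signs. (k s)\<^sup>2))"
    by (simp add: L2norm_def)
qed

section \<open>Failure of the inf-sup condition and of stability\<close>

lemma triangle_integral_zero:
  assumes "\<And>x. x \<in> convex hull {a, b, c} \<Longrightarrow> f x = 0"
  shows "triangle_integral a b c f = 0"
proof -
  have "(LINT y|lebesgue_on {(s, t). 0 \<le> s \<and> 0 \<le> t \<and> s + t \<le> (1::real)}.
      f (a + fst y *\<^sub>R (b - a) + snd y *\<^sub>R (c - a))) =
    (LINT y|lebesgue_on {(s, t). 0 \<le> s \<and> 0 \<le> t \<and> s + t \<le> (1::real)}. 0)"
  proof (rule Bochner_Integration.integral_cong[OF refl])
    fix y :: "real \<times> real"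
    assume "y \<in> space (lebesgue_on {(s, t). 0 \<le> s \<and> 0 \<le> t \<and> s + t \<le> (1::real)})"
    then have y: "0 \<le> fst y" "0 \<le> snd y" "fst y + snd y \<le> 1" by auto
    then have "a + fst y *\<^sub>R (b - a) + snd y *\<^sub>R (c - a) \<in> convex hull {a, b, c}"
      by (intro triangle_param_in_hull)
    then show "f (a + fst y *\<^sub>R (b - a) + snd y *\<^sub>R (c - a)) = 0" by (rule assms)
  qed
  then show ?thesis by (simp add: triangle_integral_def)
qed

text \<open>The zero velocity is paired with the spurious pressure to refute stability.\<close>

lemma zero_in_velocities: "(\<lambda>_. 0) \<in> velocities octa \<Gamma>"
proof -
  have trace: "elem_trace T (\<lambda>_. 0) x = 0" if "T \<in> octa" "x \<in> T" for T x
    using that elem_trace_affine[of T "\<lambda>_. 0" 0 0 x]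
    by (auto simp: octa_eq convex_tet interior_tet_nonempty)
  have L2: "(\<lambda>_. 0::real) \<in> L2 (domain octa)" by (simp add: L2_def)
  then have "(\<lambda>_. 0) \<in> H1 (domain octa)" by (auto simp: H1_def intro!: bexI[of _ "\<lambda>_. 0"])
  moreover have aff: "affine_on_element T (\<lambda>_. 0)" for T
    unfolding affine_on_element_def by (intro exI[of _ 0]) auto
  ultimately have "(\<lambda>_. 0) \<in> SC octa \<Gamma>" by (auto simp: SC_def trace)
  moreover have "(\<lambda>_. 0) \<in> SNC octa \<Gamma>"
    unfolding SNC_def using L2 aff
    by (auto intro!: triangle_integral_zero simp: trace dest!: facet_of_imp_subset subsetD)
  ultimately show ?thesis by (simp add: velocities_def)
qed

text \<open>All quotients in the supremum vanish for \<open>p\<close>, while its norm is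
  positive.\<close>

lemma not_inf_sup_if_spurious:
  assumes "p \<in> Q" "L2norm (domain \<T>) p > 0" "\<And>v. v \<in> V \<Longrightarrow> b_h \<T> v p = 0"
  shows "\<not> inf_sup \<T> V Q"
proof
  assume "inf_sup \<T> V Q"
  then obtain C :: real where C: "0 \<le> C" "ereal (L2norm (domain \<T>) p) \<le>
      ereal C * (SUP v \<in> {v \<in> V. nonzero \<T> v}. ereal (b_h \<T> v p / L2norm (domain \<T>) (grad_h \<T> v)))"
    using assms(1) unfolding inf_sup_def by blast
  \<comment> \<open>Only an upper bound is stated, since over an empty index set the supremum in
    \<open>ereal\<close> is minus infinity.\<close>
  have "(SUP v \<in> {v \<in> V. nonzero \<T> v}. ereal (b_h \<T> v p / L2norm (domain \<T>) (grad_h \<T> v))) \<le> 0"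
    by (rule SUP_least) (simp add: assms(3))
  then have "ereal C * (SUP v \<in> {v \<in> V. nonzero \<T> v}.
      ereal (b_h \<T> v p / L2norm (domain \<T>) (grad_h \<T> v))) \<le> ereal C * 0"
    using C(1) by (intro ereal_mult_left_mono) auto
  with C(2) have "ereal (L2norm (domain \<T>) p) \<le> ereal C * 0" by (rule order_trans)
  with assms(2) show False by simp
qed

text \<open>For zero load, the zero velocity together with \<open>p\<close> solves the discrete
  problem, and the stability estimate would force the norm of \<open>p\<close> to be at most 0.
  Linearity of \<open>A\<close> gives \<open>A 0 = 0\<close>.\<close>

lemma not_stokes_stable_if_spurious:
  assumes "p \<in> Q" "L2norm (domain \<T>) p > 0" "\<And>v. v \<in> V \<Longrightarrow> b_h \<T> v p = 0"
    and "(\<lambda>_. 0) \<in> V" "linear A"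
  shows "\<not> stokes_stable \<T> A V Q"
proof
  assume "stokes_stable \<T> A V Q"
  then obtain C :: real where C: "\<And>f u p. f \<in> L2 (domain \<T>) \<Longrightarrow> stokes_solution \<T> A V Q f u p \<Longrightarrow>
      L2norm (domain \<T>) (grad_h \<T> u) + L2norm (domain \<T>) p \<le> C * L2norm (domain \<T>) f"
    unfolding stokes_stable_def by blast
  have "partial i (\<lambda>_. 0) x = 0" for i x
    by (subst partial_eq[OF has_derivative_const]) simp
  then have h: "partial_h \<T> i (\<lambda>_. 0) x = 0" for i x by (simp add: partial_h_def)
  then have g: "grad_h \<T> (\<lambda>_. 0) = (\<lambda>_. 0)" by (simp add: grad_h_def fun_eq_iff vec_eq_iff)
  have "div_h \<T> (\<lambda>_. 0) x = 0" for x using h by (simp add: div_h_def)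
  then have "b_h \<T> (\<lambda>_. 0) r = 0" for r by (simp add: b_h_def)
  then have "stokes_solution \<T> A V Q (\<lambda>_. 0) (\<lambda>_. 0) p"
    using assms by (simp add: stokes_solution_def g linear_0)
  moreover have "(\<lambda>_. 0 :: real^3) \<in> L2 (domain \<T>)" by (simp add: L2_def)
  ultimately have "L2norm (domain \<T>) (\<lambda>_. 0 :: real^3^3) + L2norm (domain \<T>) p \<le>
      C * L2norm (domain \<T>) (\<lambda>_. 0 :: real^3)"
    using C g by metis
  with assms(2) show False by (simp add: L2norm_def)
qed

theorem mainTheorem5:
  fixes \<Omega> \<Gamma>\<^sub>D :: "(real^3) set"
    and V :: "(real^3 \<Rightarrow> real^3) set"
    and Q :: "(real^3 \<Rightarrow> real) set"
    and qt q :: "real^3 \<Rightarrow> real"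
  assumes \<Omega>: "\<Omega> = domain octa"
    and \<Gamma>\<^sub>D: "\<Gamma>\<^sub>D = frontier \<Omega>"
    and V: "V = velocities octa \<Gamma>\<^sub>D"
    and Q: "Q = pressures octa"
    and "\<forall>x \<in> interior (Tet 1 1 1). qt x = 1"
    and "\<forall>x \<in> interior (Tet 1 1 2). qt x = 1"
    and "\<forall>x \<in> interior (Tet 1 2 1). qt x = 0"
    and "\<forall>x \<in> interior (Tet 1 2 2). qt x = 0"
    and "\<forall>x \<in> interior (Tet 2 1 1). qt x = 0"
    and "\<forall>x \<in> interior (Tet 2 1 2). qt x = 0"
    and "\<forall>x \<in> interior (Tet 2 2 1). qt x = 1"
    and "\<forall>x \<in> interior (Tet 2 2 2). qt x = 1"
    and q: "q = (\<lambda>x. qt x - (LINT y|lebesgue_on \<Omega>. qt y))"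
  shows "(\<forall>v \<in> V. (LINT x|lebesgue_on \<Omega>. q x * div_h octa v x) = 0) \<and>
         \<not> inf_sup octa V Q \<and>
         (\<forall>A. linear A \<longrightarrow> \<not> stokes_stable octa A V Q) \<and>
         \<not> inf_sup octa V (Q \<inter> zero_mean octa) \<and>
         (\<forall>A. linear A \<longrightarrow> \<not> stokes_stable octa A V (Q \<inter> zero_mean octa))"
proof -
  have qt: "qt x = (1 + s $ 1 * s $ 2) / 2" if "s \<in> signs" "x \<in> interior (tet s)" for s x
    using that assms(5-12) unfolding signs_eq Tet_eq_tet by auto
  \<comment> \<open>Half of the equal-volume elements carry the value 1, so 1/2 is the average of
    \<open>qt\<close>. By contrast, \<open>q\<close> subtracts the integral of
    \<open>qt\<close>.\<close>
  define q\<^sub>0 where "q\<^sub>0 x = qt x - 1 / 2" for x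
  have V0: "(\<lambda>_. 0) \<in> V" unfolding V by (rule zero_in_velocities)
  have shift: "(\<forall>v\<in>V. (LINT x|lebesgue_on \<Omega>. p x * div_h octa v x) = 0) \<and>
      p \<in> Q \<and> L2norm (domain octa) p > 0" if "p = (\<lambda>x. qt x - c)" for p c
  proof -
    have p: "p x = (1 + s $ 1 * s $ 2) / 2 - c" if "s \<in> signs" "x \<in> interior (tet s)" for s x
      using qt that \<open>p = _\<close> by simp
    \<comment> \<open>Four elements carry the value \<open>1 - c\<close> and four the value
      \<open>- c\<close>; these cannot both be zero.\<close>
    have "(\<Sum>s\<in>signs. ((1 + s $ 1 * s $ 2) / 2 - c)\<^sup>2) = 4 * (1 - c)\<^sup>2 + 4 * c\<^sup>2"
      by (simp add: sum_signs)
    also have "\<dots> > 0"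
      by (cases "c = 0") (auto intro: add_nonneg_pos)
    finally have "(\<Sum>s\<in>signs. ((1 + s $ 1 * s $ 2) / 2 - c)\<^sup>2) > 0" .
    then have "L2norm (domain octa) p > 0"
      by (subst pressures_piecewise_const(2)[OF p]) (auto simp: tet_volume_pos)
    moreover have "p \<in> Q" unfolding Q by (rule pressures_piecewise_const(1)[OF p])
    moreover have "(LINT x|lebesgue_on \<Omega>. p x * div_h octa v x) = 0" if "v \<in> V" for v
      using that unfolding V \<Gamma>\<^sub>D \<Omega> by (rule velocity_div_orthogonal) (rule p)
    ultimately show ?thesis by blast
  qed
  have b: "b_h octa v p = 0" if "v \<in> V" "p = (\<lambda>x. qt x - c)" for v p c
    using shift[OF that(2)] that(1) unfolding b_h_def \<Omega> by simp
  have "(LINT x|lebesgue_on (domain octa). q\<^sub>0 x) =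
      tet_volume * (\<Sum>s\<in>signs. (1 + s $ 1 * s $ 2) / 2 - 1 / 2)"
    by (rule integral_piecewise_const(2)) (simp add: q\<^sub>0_def qt)
  also have "\<dots> = 0" by (simp add: sum_signs)
  finally have "q\<^sub>0 \<in> zero_mean octa" by (simp add: zero_mean_def)
  moreover have q0: "q\<^sub>0 = (\<lambda>x. qt x - 1 / 2)" by (simp add: q\<^sub>0_def fun_eq_iff)
  ultimately have q0_in: "q\<^sub>0 \<in> Q \<inter> zero_mean octa" using shift by blast
  note q' = shift[OF q] and q0' = shift[OF q0]
  show ?thesis
    using not_inf_sup_if_spurious[of q Q octa V] not_inf_sup_if_spurious[OF q0_in, of octa V]
      not_stokes_stable_if_spurious[of q Q octa V] not_stokes_stable_if_spurious[OF q0_in, of octa V]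
      q' q0' b[OF _ q] b[OF _ q0] V0 by blast
qed

end
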